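(* Let $E_*=(E_1,\dots,E_n)$ be a complete exceptional sequence for the linear quiver of type $A_n$ with rooted labeled forest $F$, and let $1\le i<n$. Then the rooted labeled forest of the complete exceptional sequence $\sigma_i(E_* )$ is $\sigma_i(F)$. That is, the action of $\sigma_i$ on rooted labeled forests defined combinatorially in the context corresponds to the action of $\sigma_i$ on complete exceptional sequences under the bijection between complete exceptional sequences and rooted labeled forests.
   Context: Let $K$ be a field, $Q: 1\to 2\to\cdots\to n$, $\Lambda=KQ$; modules are finite-dimensional representations of $Q$ over $K$. The indecomposable modules are the $M_{ab}$, $1\le a\le b\le n$, with $K$ at vertices $a,\dots,b$, identity maps between them, and $0$ elsewhere; the support of $M_{ab}$ is $[a,b]$. A complete exceptional sequence is a sequence $(E_1,\dots,E_n)$ of rigid indecomposable modules (up to isomorphism) such that $\mathrm{Hom}(E_j,E_i)=0=\mathrm{Ext}^1(E_j,E_i)$ for all $i<j$. A rooted labeled forest on $n$ is a forest with vertices $v_1,\dots,v_n$ and a chosen root in each component; $v_i\le v_j$ iff $v_j$ is on the path from $v_i$ to the root of its component. The forest of $E_*$ is the Hasse diagram of the order $v_i\le v_j$ iff $\mathrm{supp}\,E_i\subseteq \mathrm{supp}\,E_j$; this gives a bijection from complete exceptional sequences to rooted labeled forests on $n$. For a forest $F$, $F_+$ denotes the rooted tree obtained by adding a new root $v_0$ (the master root) as the parent of all the roots of $F$. "Siblings" are nodes with the same parent (so roots of $F$ are siblings in $F_+$). Two nodes of $F$ are close if they are siblings in $F_+$ or one is the parent of the other. Action on exceptional sequences: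 $\sigma_i(E_* )=(E_1,\dots,E_{i-1},E_i',E_i,E_{i+2},\dots,E_n)$, where $E_i'$ is the unique (up to isomorphism) module making this a complete exceptional sequence. Action on forests: in $\sigma_i(F)$ the nodes labeled $j\ne i,i+1$ keep their names $v_j$, and the nodes labeled $i,i+1$ are denoted $v_i',v_{i+1}'$. Relations not mentioned below are unchanged. Case 0: if $v_i,v_{i+1}$ are not close, $\sigma_i(F)$ is $F$ with the labels $i,i+1$ switched. Case 1: $v_i$ is the parent of $v_{i+1}$, $v_k$ is the parent of $v_i$ in $F_+$, $X$ is the set of other children of $v_i$, $Y$ the set of children of $v_{i+1}$. Then in $\sigma_i(F)_+$: $v_{i+1}'$ has parent $v_k$ and set of children $Y\cup\{v_i'\}$, and $v_i'$ has set of children $X$. Case 2: $v_i$ is a child of $v_{i+1}$, $v_k$ is the parent of $v_{i+1}$ in $F_+$, $Y$ is the set of other children of $v_{i+1}$, $X$ the set of children of $v_i$. Then in $\sigma_i(F)_+$: $v_i'$ and $v_{i+1}'$ are both children of $v_k$, $v_i'$ has set of children $Y$, and $v_{i+1}'$ has set of children $X$. Case 3: $v_i,v_{i+1}$ are siblings in $F_+$ with parent $v_k$, and $Y,X$ are the sets of children of $v_i,v_{i+1}$ respectively. Then in $\sigma_i(F)_+$: $v_i'$ has parent $v_k$ and set of children $X\cup\{v_{i+1}'\}$, and $v_{i+1}'$ has set of children $Y$. *)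

theory Defs
  imports "Jordan_Normal_Form.Matrix_Kernel" "HOL-Combinatorics.Transposition"
begin

section \<open>Representations of the linear quiver\<close>

text \<open>
  A finite-dimensional representation of $1 \to 2 \to \cdots \to n$ over the field
  \<open>'k\<close> has the space \<open>carrier_vec (vdim V j)\<close> of column vectors at vertex \<open>j\<close>; the arrow from
  \<open>j\<close> to \<open>j + 1\<close> acts by the matrix \<open>arr V j\<close>. Every finite-dimensional representation
  is isomorphic to one of this form. Only the values of \<open>vdim\<close> on \<open>{1..n}\<close> and of \<open>arr\<close>
  on \<open>{1..<n}\<close> are meaningful.
\<close>

record 'k qrep =
  vdim :: "nat \<Rightarrow> nat"
  arr :: "nat \<Rightarrow> 'k mat"

definition is_rep :: "nat \<Rightarrow> 'k::field qrep \<Rightarrow> bool" where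
  "is_rep n V \<longleftrightarrow> (\<forall>j\<in>{1..<n}. arr V j \<in> carrier_mat (vdim V (j + 1)) (vdim V j))"

definition supp :: "nat \<Rightarrow> 'k::field qrep \<Rightarrow> nat set" where
  "supp n V = {j \<in> {1..n}. vdim V j \<noteq> 0}"

definition is_hom :: "nat \<Rightarrow> 'k::field qrep \<Rightarrow> 'k qrep \<Rightarrow> (nat \<Rightarrow> 'k mat) \<Rightarrow> bool" where
  "is_hom n V W f \<longleftrightarrow>
     (\<forall>j\<in>{1..n}. f j \<in> carrier_mat (vdim W j) (vdim V j)) \<and>
     (\<forall>j\<in>{1..<n}. f (j + 1) * arr V j = arr W j * f j)"

definition hom_vanishes :: "nat \<Rightarrow> 'k::field qrep \<Rightarrow> 'k qrep \<Rightarrow> bool" where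
  "hom_vanishes n V W \<longleftrightarrow>
     (\<forall>f. is_hom n V W f \<longrightarrow> (\<forall>j\<in>{1..n}. f j = 0\<^sub>m (vdim W j) (vdim V j)))"

text \<open>\<open>short_exact n N f X g M\<close> says that $0 \to N \to X \to M \to 0$ is exact, with maps
  \<open>f\<close> and \<open>g\<close>.\<close>

definition short_exact ::
  "nat \<Rightarrow> 'k::field qrep \<Rightarrow> (nat \<Rightarrow> 'k mat) \<Rightarrow> 'k qrep \<Rightarrow> (nat \<Rightarrow> 'k mat) \<Rightarrow> 'k qrep \<Rightarrow> bool" where
  "short_exact n N f X g M \<longleftrightarrow>
     is_rep n N \<and> is_rep n X \<and> is_rep n M \<and> is_hom n N X f \<and> is_hom n X M g \<and>
     (\<forall>j\<in>{1..n}.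
        inj_on (\<lambda>v. f j *\<^sub>v v) (carrier_vec (vdim N j)) \<and>
        (\<lambda>v. f j *\<^sub>v v) ` carrier_vec (vdim N j) = mat_kernel (g j) \<and>
        (\<lambda>v. g j *\<^sub>v v) ` carrier_vec (vdim X j) = carrier_vec (vdim M j))"

text \<open>The group $\mathrm{Ext}^1(M,N)$ of extension classes of \<open>M\<close> by \<open>N\<close> (Yoneda) is zero
  when every such extension splits.\<close>

definition ext1_vanishes :: "nat \<Rightarrow> 'k::field qrep \<Rightarrow> 'k qrep \<Rightarrow> bool" where
  "ext1_vanishes n M N \<longleftrightarrow>
     (\<forall>f X g. short_exact n N f X g M \<longrightarrow>
        (\<exists>s. is_hom n M X s \<and> (\<forall>j\<in>{1..n}. g j * s j = 1\<^sub>m (vdim M j))))"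

definition rigid :: "nat \<Rightarrow> 'k::field qrep \<Rightarrow> bool" where
  "rigid n V \<longleftrightarrow> ext1_vanishes n V V"

definition subrep :: "nat \<Rightarrow> 'k::field qrep \<Rightarrow> (nat \<Rightarrow> 'k vec set) \<Rightarrow> bool" where
  "subrep n V U \<longleftrightarrow>
     (\<forall>j\<in>{1..n}. subspace class_ring (U j) (module_vec TYPE('k) (vdim V j))) \<and>
     (\<forall>j\<in>{1..<n}. \<forall>u\<in>U j. arr V j *\<^sub>v u \<in> U (j + 1))"

definition nonzero_subrep :: "nat \<Rightarrow> 'k::field qrep \<Rightarrow> (nat \<Rightarrow> 'k vec set) \<Rightarrow> bool" where
  "nonzero_subrep n V U \<longleftrightarrow> subrep n V U \<and> (\<exists>j\<in>{1..n}. U j \<noteq> {0\<^sub>v (vdim V j)})"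

definition is_direct_sum ::
  "nat \<Rightarrow> 'k::field qrep \<Rightarrow> (nat \<Rightarrow> 'k vec set) \<Rightarrow> (nat \<Rightarrow> 'k vec set) \<Rightarrow> bool" where
  "is_direct_sum n V U W \<longleftrightarrow>
     (\<forall>j\<in>{1..n}. {u + w | u w. u \<in> U j \<and> w \<in> W j} = carrier_vec (vdim V j) \<and>
                 U j \<inter> W j = {0\<^sub>v (vdim V j)})"

definition indecomposable :: "nat \<Rightarrow> 'k::field qrep \<Rightarrow> bool" where
  "indecomposable n V \<longleftrightarrow>
     is_rep n V \<and> (\<exists>j\<in>{1..n}. vdim V j \<noteq> 0) \<and>
     \<not> (\<exists>U W. nonzero_subrep n V U \<and> nonzero_subrep n V W \<and> is_direct_sum n V U W)"


section \<open>Complete exceptional sequences\<close>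

text \<open>The sequence $(E_1,\dots,E_n)$ is a function on indices; its values outside
  \<open>{1..n}\<close> are irrelevant.\<close>

definition complete_exceptional :: "nat \<Rightarrow> (nat \<Rightarrow> 'k::field qrep) \<Rightarrow> bool" where
  "complete_exceptional n E \<longleftrightarrow>
     (\<forall>i\<in>{1..n}. indecomposable n (E i) \<and> rigid n (E i)) \<and>
     (\<forall>i\<in>{1..n}. \<forall>j\<in>{1..n}. i < j \<longrightarrow>
        hom_vanishes n (E j) (E i) \<and> ext1_vanishes n (E j) (E i))"

text \<open>The module \<open>X\<close> is determined only up to isomorphism; \<open>SOME\<close> picks a representative
  of its isomorphism class.\<close>

definition sigma_seq :: "nat \<Rightarrow> nat \<Rightarrow> (nat \<Rightarrow> 'k::field qrep) \<Rightarrow> (nat \<Rightarrow> 'k qrep)" where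
  "sigma_seq n i E =
     E(i := (SOME X. complete_exceptional n (E(i := X, i + 1 := E i))), i + 1 := E i)"


section \<open>Rooted labeled forests\<close>

text \<open>
  A rooted labeled forest on $n$ is given by its edges \<open>(child, parent)\<close> on the labels
  $1,\dots,n$. Each node has at most one parent, the roots being the nodes without one.
  The label \<open>0\<close> is reserved for the master root.
\<close>

definition rooted_labeled_forest :: "nat \<Rightarrow> (nat \<times> nat) set \<Rightarrow> bool" where
  "rooted_labeled_forest n F \<longleftrightarrow> F \<subseteq> {1..n} \<times> {1..n} \<and> single_valued F \<and> acyclic F"

definition forest_of :: "nat \<Rightarrow> (nat \<Rightarrow> 'k::field qrep) \<Rightarrow> (nat \<times> nat) set" where
  "forest_of n E =
     {(i, j). i \<in> {1..n} \<and> j \<in> {1..n} \<and> i \<noteq> j \<and> supp n (E i) \<subseteq> supp n (E j) \<and>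
        \<not> (\<exists>k\<in>{1..n} - {i, j}. supp n (E i) \<subseteq> supp n (E k) \<and> supp n (E k) \<subseteq> supp n (E j))}"

definition forest_plus :: "nat \<Rightarrow> (nat \<times> nat) set \<Rightarrow> (nat \<times> nat) set" where
  "forest_plus n F = F \<union> {(r, 0) | r. r \<in> {1..n} \<and> (\<nexists>w. (r, w) \<in> F)}"

definition parent :: "(nat \<times> nat) set \<Rightarrow> nat \<Rightarrow> nat" where
  "parent T v = (THE w. (v, w) \<in> T)"

definition children :: "(nat \<times> nat) set \<Rightarrow> nat \<Rightarrow> nat set" where
  "children T v = {u. (u, v) \<in> T}"

definition siblings :: "(nat \<times> nat) set \<Rightarrow> nat \<Rightarrow> nat \<Rightarrow> bool" where
  "siblings T u v \<longleftrightarrow> (\<exists>k. (u, k) \<in> T \<and> (v, k) \<in> T)"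

definition close :: "(nat \<times> nat) set \<Rightarrow> nat \<Rightarrow> nat \<Rightarrow> bool" where
  "close T u v \<longleftrightarrow> siblings T u v \<or> (u, v) \<in> T \<or> (v, u) \<in> T"

text \<open>In the last three branches all edges at \<open>i\<close> and \<open>i + 1\<close> are removed and the new ones
  are inserted; \<open>S \<times> {v}\<close> makes the nodes in \<open>S\<close> children of \<open>v\<close>. The argument \<open>T\<close> is
  a tree with master root \<open>0\<close>.\<close>

definition sigma_tree :: "nat \<Rightarrow> (nat \<times> nat) set \<Rightarrow> (nat \<times> nat) set" where
  "sigma_tree i T =
     (let unchanged = {(u, v) \<in> T. u \<notin> {i, i + 1} \<and> v \<notin> {i, i + 1}} in
      if \<not> close T i (i + 1) then
        map_prod (transpose i (i + 1)) (transpose i (i + 1)) ` T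
      else if (i + 1, i) \<in> T then
        (let k = parent T i; X = children T i - {i + 1}; Y = children T (i + 1)
         in unchanged \<union> {(i + 1, k)} \<union> (Y \<union> {i}) \<times> {i + 1} \<union> X \<times> {i})
      else if (i, i + 1) \<in> T then
        (let k = parent T (i + 1); Y = children T (i + 1) - {i}; X = children T i
         in unchanged \<union> {(i, k), (i + 1, k)} \<union> Y \<times> {i} \<union> X \<times> {i + 1})
      else
        (let k = parent T i; Y = children T i; X = children T (i + 1)
         in unchanged \<union> {(i, k)} \<union> (X \<union> {i + 1}) \<times> {i} \<union> Y \<times> {i + 1}))"

definition sigma_forest :: "nat \<Rightarrow> nat \<Rightarrow> (nat \<times> nat) set \<Rightarrow> (nat \<times> nat) set" where
  "sigma_forest n i F = {(u, v) \<in> sigma_tree i (forest_plus n F). v \<noteq> 0}"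

end

theory Submission
  imports Defs
begin

text \<open>
  Indecomposable representations are the interval modules, and the vanishing of \<open>Hom\<close> and
  \<open>Ext\<^sup>1\<close> between two of them is an inequality between end points, so that an
  exceptional sequence becomes a sequence of pairwise compatible intervals. Two compatible intervals
  are nested or disjoint; if they share the left end point, the larger one comes first; if they share
  the right end point, the larger one comes last; if they are adjacent, the left one comes first.

  If an interval \<open>I\<close> were covered by strictly smaller intervals of the sequence, the maximal
  ones among them would form a chain of adjacent intervals that is increasing in the order of the
  sequence; but the first of them comes after \<open>I\<close> and the last one before \<open>I\<close>. So every
  interval has an uncovered point (a gap). Gaps of different intervals differ; hence a sequence has at
  most \<open>n\<close> members, and in a complete sequence every interval has exactly one gap. The chain
  argument on the two sides of this gap shows that, of the intervals at positions \<open>i\<close> and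
  \<open>i + 1\<close>, a child at position \<open>i + 1\<close> has the left end point of its parent, a child at
  position \<open>i\<close> has the right end point of its parent, and siblings are adjacent. The interval
  of the new module is the difference of the two intervals in the first two cases and their union in
  the third; if the two nodes are not close, they may simply be exchanged. The new module is unique,
  since two different solutions would allow an exceptional sequence of length \<open>n + 1\<close>.
\<close>

section \<open>Extensions and coboundaries\<close>

text \<open>Two choices in the definitions shape the argument. \<open>sigma_seq\<close> picks the
  new module by \<open>SOME\<close>, so nothing is known of it beyond exceptionality of the
  resulting sequence: existence has to come from an explicit interval, and the support of the chosen
  module is then identified by a uniqueness statement about intervals alone. And
  \<open>ext1_vanishes\<close> speaks of the splitting of all short exact sequences, so a
  computation with matrices first needs cochains. On the combinatorial side the new Hasse diagram is
  not determined edge by edge in both directions. Each node has at most one parent, so it suffices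
  that the edges prescribed by \<open>sigma_tree\<close> occur and that no node with a parent is
  missed. The gap of an interval does a second job there: the gap of a parent stays in the
  difference of parent and child, so no other member of the family can be squeezed between this
  difference and the parent.\<close>

lemma mat_eq_on_vecI:
  fixes A B :: "'a :: semiring_1 mat"
  assumes A: "A \<in> carrier_mat nr nc" and B: "B \<in> carrier_mat nr nc"
    and eq: "\<And>v. v \<in> carrier_vec nc \<Longrightarrow> A *\<^sub>v v = B *\<^sub>v v"
  shows "A = B"
proof (rule eq_matI)
  fix i j assume "i < dim_row B" "j < dim_col B"
  then have ij: "i < nr" "j < nc" using B by auto
  have "(A *\<^sub>v unit_vec nc j) $ i = (B *\<^sub>v unit_vec nc j) $ i" using eq by simp
  then show "A $$ (i, j) = B $$ (i, j)" using A B ij by simp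
qed (use A B in auto)

lemma zero_mat_mult_vec:
  fixes v :: "'a :: semiring_1 vec"
  assumes "v \<in> carrier_vec nc" shows "0\<^sub>m nr nc *\<^sub>v v = 0\<^sub>v nr"
  using assms by (intro eq_vecI) auto

lemma mat_mult_zero_vec:
  fixes A :: "'a :: semiring_1 mat"
  assumes "A \<in> carrier_mat nr nc" shows "A *\<^sub>v 0\<^sub>v nc = 0\<^sub>v nr"
  using assms by (intro eq_vecI) auto

lemma add_diff_mat:
  fixes A B :: "'a :: ab_group_add mat"
  assumes "A \<in> carrier_mat nr nc" "B \<in> carrier_mat nr nc"
  shows "B + (A - B) = A"
  using assms by (intro eq_matI) auto

text \<open>Preimages are chosen column by column. In the splitting argument this yields vertexwise
  sections of \<open>g\<close>, and it lifts a matrix through \<open>f\<close> once its columns lie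
  in the kernel of \<open>g\<close>.\<close>

lemma mat_factor_through:
  fixes A B :: "'a :: semiring_1 mat"
  assumes A: "A \<in> carrier_mat r c" and B: "B \<in> carrier_mat r k"
    and im: "\<And>j. j < k \<Longrightarrow> col B j \<in> (\<lambda>v. A *\<^sub>v v) ` carrier_vec c"
  obtains C where "C \<in> carrier_mat c k" "A * C = B"
proof -
  have "\<exists>v. v \<in> carrier_vec c \<and> A *\<^sub>v v = col B j" if "j < k" for j
    using im[OF that] by force
  then obtain h where h: "\<And>j. j < k \<Longrightarrow> h j \<in> carrier_vec c \<and> A *\<^sub>v h j = col B j"
    by metis
  define C where "C = mat_of_cols c (map h [0..<k])"
  have C: "C \<in> carrier_mat c k" 
    using mat_of_cols_carrier(1)[of c "map h [0..<k]"] by (simp add: C_def)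
  moreover have "A * C = B"
  proof (rule mat_col_eqI)
    fix j assume "j < dim_col B"
    then have j: "j < k" using B by simp
    have "col C j = h j" using h[OF j] j by (simp add: C_def)
    then show "col (A * C) j = col B j" using col_mult2[OF A C j] h[OF j] by simp
  qed (use A B C in auto)
  ultimately show ?thesis using that by blast
qed

text \<open>On the cochain level, \<open>Ext\<^sup>1(M, N)\<close> is the cokernel of the map that sends a family
  \<open>u\<^sub>j : M\<^sub>j \<rightarrow> N\<^sub>j\<close> to the family \<open>u\<^sub>j\<^sub>+\<^sub>1 M\<^sub>j - N\<^sub>j u\<^sub>j : M\<^sub>j \<rightarrow> N\<^sub>j\<^sub>+\<^sub>1\<close>.\<close>

definition coboundaries_full :: "nat \<Rightarrow> 'k::field qrep \<Rightarrow> 'k qrep \<Rightarrow> bool" where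
  "coboundaries_full n M N \<longleftrightarrow>
     (\<forall>\<phi>. (\<forall>j\<in>{1..<n}. \<phi> j \<in> carrier_mat (vdim N (j + 1)) (vdim M j)) \<longrightarrow>
       (\<exists>u. (\<forall>j\<in>{1..n}. u j \<in> carrier_mat (vdim N j) (vdim M j)) \<and>
         (\<forall>j\<in>{1..<n}. u (j + 1) * arr M j = arr N j * u j + \<phi> j)))"

text \<open>Vertexwise sections \<open>s\<close> of \<open>g\<close> need not commute with the
  arrows. Their defect is killed by \<open>g\<close>, hence is the image under \<open>f\<close> of a
  cochain \<open>\<phi>\<close>; if \<open>u\<close> bounds \<open>\<phi>\<close>, then
  \<open>s + f u\<close> does commute.\<close>

lemma ext1_vanishes_if_coboundaries_full:
  assumes full: "coboundaries_full n M N"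
  shows "ext1_vanishes n M N"
  unfolding ext1_vanishes_def
proof (intro allI impI)
  fix f X g assume se: "short_exact n N f X g M"
  have f: "f j \<in> carrier_mat (vdim X j) (vdim N j)"
    and g: "g j \<in> carrier_mat (vdim M j) (vdim X j)"
    and ker: "(\<lambda>v. f j *\<^sub>v v) ` carrier_vec (vdim N j) = mat_kernel (g j)"
    and surj: "(\<lambda>v. g j *\<^sub>v v) ` carrier_vec (vdim X j) = carrier_vec (vdim M j)"
    if "j \<in> {1..n}" for j
    using se that unfolding short_exact_def is_hom_def by auto
  have N: "arr N j \<in> carrier_mat (vdim N (j + 1)) (vdim N j)"
    and X: "arr X j \<in> carrier_mat (vdim X (j + 1)) (vdim X j)"
    and M: "arr M j \<in> carrier_mat (vdim M (j + 1)) (vdim M j)"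
    and fN: "f (j + 1) * arr N j = arr X j * f j"
    and gX: "g (j + 1) * arr X j = arr M j * g j"
    if "j \<in> {1..<n}" for j
    using se that unfolding short_exact_def is_hom_def is_rep_def by auto
  have "\<exists>s. s \<in> carrier_mat (vdim X j) (vdim M j) \<and> g j * s = 1\<^sub>m (vdim M j)"
    if j: "j \<in> {1..n}" for j
    by (rule mat_factor_through[OF g[OF j] one_carrier_mat]) (use surj[OF j] in auto)
  then obtain s where s: "\<And>j. j \<in> {1..n} \<Longrightarrow> s j \<in> carrier_mat (vdim X j) (vdim M j)"
    and gs: "\<And>j. j \<in> {1..n} \<Longrightarrow> g j * s j = 1\<^sub>m (vdim M j)" by metis
  have "\<exists>\<phi>. \<phi> \<in> carrier_mat (vdim N (j + 1)) (vdim M j) \<and>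
      f (j + 1) * \<phi> = arr X j * s j - s (j + 1) * arr M j" if j: "j \<in> {1..<n}" for j
  proof -
    have j1: "j \<in> {1..n}" "j + 1 \<in> {1..n}" using j by auto
    note c = N[OF j] X[OF j] M[OF j] f[OF j1(1)] f[OF j1(2)] g[OF j1(1)] g[OF j1(2)]
      s[OF j1(1)] s[OF j1(2)]
    let ?D = "arr X j * s j - s (j + 1) * arr M j"
    have D: "?D \<in> carrier_mat (vdim X (j + 1)) (vdim M j)" using c by auto
    have "g (j + 1) * ?D = g (j + 1) * (arr X j * s j) - g (j + 1) * (s (j + 1) * arr M j)"
      using c by (intro mult_minus_distrib_mat) auto
    also have "g (j + 1) * (arr X j * s j) = arr M j * (g j * s j)"
      using assoc_mult_mat[OF c(7) c(2) c(8)] assoc_mult_mat[OF c(3) c(6) c(8)] gX[OF j] by simp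
    also have "\<dots> = arr M j" using gs[OF j1(1)] c(3) by simp
    also have "g (j + 1) * (s (j + 1) * arr M j) = arr M j"
      using assoc_mult_mat[OF c(7) c(9) c(3)] gs[OF j1(2)] c(3) by simp
    finally have gD: "g (j + 1) * ?D = 0\<^sub>m (vdim M (j + 1)) (vdim M j)" using c(3) by simp
    show ?thesis
    proof (rule mat_factor_through[OF c(5) D])
      fix k assume k: "k < vdim M j"
      have "g (j + 1) *\<^sub>v col ?D k = col (g (j + 1) * ?D) k"
        using col_mult2[OF c(7) D k] by simp
      also have "\<dots> = 0\<^sub>v (vdim M (j + 1))" using gD k by simp
      finally have g0: "g (j + 1) *\<^sub>v col ?D k = 0\<^sub>v (vdim M (j + 1))" .
      have "col ?D k \<in> carrier_vec (vdim X (j + 1))"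
        using col_dim[of ?D k] carrier_matD(1)[OF D] by metis
      then have "col ?D k \<in> mat_kernel (g (j + 1))" using mat_kernelI[OF c(7)] g0 by blast
      then show "col ?D k \<in> (\<lambda>v. f (j + 1) *\<^sub>v v) ` carrier_vec (vdim N (j + 1))"
        using ker[OF j1(2)] by simp
    qed auto
  qed
  then obtain \<phi> where \<phi>: "\<And>j. j \<in> {1..<n} \<Longrightarrow> \<phi> j \<in> carrier_mat (vdim N (j + 1)) (vdim M j)"
    and f\<phi>: "\<And>j. j \<in> {1..<n} \<Longrightarrow> f (j + 1) * \<phi> j = arr X j * s j - s (j + 1) * arr M j"
    by metis
  obtain u where u: "\<And>j. j \<in> {1..n} \<Longrightarrow> u j \<in> carrier_mat (vdim N j) (vdim M j)"
    and eq: "\<And>j. j \<in> {1..<n} \<Longrightarrow> u (j + 1) * arr M j = arr N j * u j + \<phi> j"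
    using full \<phi> unfolding coboundaries_full_def by blast
  let ?s = "\<lambda>j. s j + f j * u j"
  have "is_hom n M X ?s"
    unfolding is_hom_def
  proof (intro conjI ballI)
    fix j assume j: "j \<in> {1..n}"
    show "?s j \<in> carrier_mat (vdim X j) (vdim M j)"
      by (rule add_carrier_mat[OF mult_carrier_mat[OF f[OF j] u[OF j]]])
  next
    fix j assume j: "j \<in> {1..<n}"
    have j1: "j \<in> {1..n}" "j + 1 \<in> {1..n}" using j by auto
    note c = N[OF j] X[OF j] M[OF j] f[OF j1(1)] f[OF j1(2)] u[OF j1(1)] u[OF j1(2)]
      s[OF j1(1)] s[OF j1(2)] \<phi>[OF j]
    let ?A = "s (j + 1) * arr M j" and ?B = "f (j + 1) * (arr N j * u j)" and ?C = "f (j + 1) * \<phi> j"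
    have car: "?A \<in> carrier_mat (vdim X (j + 1)) (vdim M j)"
      "?B \<in> carrier_mat (vdim X (j + 1)) (vdim M j)"
      "?C \<in> carrier_mat (vdim X (j + 1)) (vdim M j)"
      "arr X j * s j \<in> carrier_mat (vdim X (j + 1)) (vdim M j)" using c by auto
    have "?s (j + 1) * arr M j = ?A + (f (j + 1) * u (j + 1)) * arr M j"
      using c by (intro add_mult_distrib_mat) auto
    also have "(f (j + 1) * u (j + 1)) * arr M j = f (j + 1) * (arr N j * u j + \<phi> j)"
      using assoc_mult_mat[OF c(5) c(7) c(3)] eq[OF j] by simp
    also have "\<dots> = ?B + ?C" using c by (intro mult_add_distrib_mat) auto
    finally have l: "?s (j + 1) * arr M j = ?A + (?B + ?C)" .
    have "arr X j * ?s j = arr X j * s j + arr X j * (f j * u j)"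
      using c by (intro mult_add_distrib_mat) auto
    also have "arr X j * (f j * u j) = ?B"
      using assoc_mult_mat[OF c(2) c(4) c(6)] assoc_mult_mat[OF c(5) c(1) c(6)] fN[OF j] by simp
    also have "arr X j * s j = ?A + ?C"
      unfolding f\<phi>[OF j] using add_diff_mat[OF car(4,1)] by simp
    finally have "arr X j * ?s j = (?A + ?C) + ?B" .
    then show "?s (j + 1) * arr M j = arr X j * ?s j"
      unfolding l using assoc_add_mat[OF car(1,3,2)] comm_add_mat[OF car(3,2)] by simp
  qed
  moreover have "g j * ?s j = 1\<^sub>m (vdim M j)" if j: "j \<in> {1..n}" for j
  proof -
    note c = f[OF j] g[OF j] s[OF j] u[OF j]
    have "g j * f j = 0\<^sub>m (vdim M j) (vdim N j)"
    proof (rule mat_eq_on_vecI)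
      fix v :: "'a vec" assume v: "v \<in> carrier_vec (vdim N j)"
      then have "f j *\<^sub>v v \<in> mat_kernel (g j)" using ker[OF j] by blast
      then show "(g j * f j) *\<^sub>v v = 0\<^sub>m (vdim M j) (vdim N j) *\<^sub>v v"
        using mat_kernelD[OF c(2)] assoc_mult_mat_vec[OF c(2,1) v]
          zero_mat_mult_vec[OF v] by simp
    qed (use c in auto)
    then have "g j * (f j * u j) = 0\<^sub>m (vdim M j) (vdim M j)"
      using assoc_mult_mat[OF c(2,1,4)] c(4) by simp
    moreover have "g j * ?s j = g j * s j + g j * (f j * u j)"
      using c by (intro mult_add_distrib_mat) auto
    ultimately show ?thesis using gs[OF j] by simp
  qed
  ultimately show "\<exists>s. is_hom n M X s \<and> (\<forall>j\<in>{1..n}. g j * s j = 1\<^sub>m (vdim M j))" by blast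
qed

text \<open>A cochain is the off-diagonal block of an extension of \<open>M\<close> by
  \<open>N\<close> on the direct sums of the spaces. A splitting has the form \<open>(u, 1)\<close>,
  and its commutation with the arrows is the coboundary equation for \<open>u\<close>.\<close>

lemma coboundaries_full_if_ext1_vanishes:
  fixes M N :: "'k::field qrep"
  assumes repM: "is_rep n M" and repN: "is_rep n N" and ext: "ext1_vanishes n M N"
  shows "coboundaries_full n M N"
  unfolding coboundaries_full_def
proof (intro allI impI)
  fix \<phi> :: "nat \<Rightarrow> 'k mat"
  assume \<phi>: "\<forall>j\<in>{1..<n}. \<phi> j \<in> carrier_mat (vdim N (j + 1)) (vdim M j)"
  define X :: "'k qrep" where "X = \<lparr>vdim = (\<lambda>j. vdim N j + vdim M j),
    arr = (\<lambda>j. four_block_mat (arr N j) (\<phi> j) (0\<^sub>m (vdim M (j + 1)) (vdim N j)) (arr M j))\<rparr>"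
  define f :: "nat \<Rightarrow> 'k mat" where "f j = 1\<^sub>m (vdim N j) @\<^sub>r 0\<^sub>m (vdim M j) (vdim N j)" for j
  \<comment> \<open>The projection onto \<open>M\<close>, padded with two blocks without rows so
    that the product rule for four-block matrices applies.\<close>
  define g :: "nat \<Rightarrow> 'k mat" where
    "g j = four_block_mat (0\<^sub>m (vdim M j) (vdim N j)) (1\<^sub>m (vdim M j))
       (0\<^sub>m 0 (vdim N j)) (0\<^sub>m 0 (vdim M j))" for j
  have N: "arr N j \<in> carrier_mat (vdim N (j + 1)) (vdim N j)"
    and M: "arr M j \<in> carrier_mat (vdim M (j + 1)) (vdim M j)" if "j \<in> {1..<n}" for j
    using repM repN that by (auto simp: is_rep_def)
  have f: "f j \<in> carrier_mat (vdim X j) (vdim N j)" for j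
    unfolding f_def X_def by simp
  have g: "g j \<in> carrier_mat (vdim M j) (vdim X j)" for j
    unfolding g_def X_def
    using four_block_carrier_mat[of "0\<^sub>m (vdim M j) (vdim N j)" "vdim M j" "vdim N j"
        "0\<^sub>m 0 (vdim M j)" 0 "vdim M j"] by simp
  have X: "arr X j \<in> carrier_mat (vdim X (j + 1)) (vdim X j)" if "j \<in> {1..<n}" for j
    using N[OF that] M[OF that] unfolding X_def by simp
  have fv: "f j *\<^sub>v v = v @\<^sub>v 0\<^sub>v (vdim M j)" if "v \<in> carrier_vec (vdim N j)" for j v
    unfolding f_def using mat_mult_append[OF one_carrier_mat zero_carrier_mat that] that
      zero_mat_mult_vec[OF that] by simp
  have gv: "g j *\<^sub>v (a @\<^sub>v d) = d"
    if "a \<in> carrier_vec (vdim N j)" "d \<in> carrier_vec (vdim M j)" for j a d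
  proof -
    have "g j *\<^sub>v (a @\<^sub>v d) = (0\<^sub>m (vdim M j) (vdim N j) *\<^sub>v a + 1\<^sub>m (vdim M j) *\<^sub>v d)
        @\<^sub>v (0\<^sub>m 0 (vdim N j) *\<^sub>v a + 0\<^sub>m 0 (vdim M j) *\<^sub>v d)"
      unfolding g_def
      by (rule four_block_mat_mult_vec[OF zero_carrier_mat one_carrier_mat zero_carrier_mat
            zero_carrier_mat that])
    also have "\<dots> = d"
      using that by (intro eq_vecI) (auto simp: zero_mat_mult_vec[OF that(1)])
    finally show ?thesis .
  qed
  have Xv: "arr X j *\<^sub>v (a @\<^sub>v d) = (arr N j *\<^sub>v a + \<phi> j *\<^sub>v d) @\<^sub>v (arr M j *\<^sub>v d)"
    if "j \<in> {1..<n}" "a \<in> carrier_vec (vdim N j)" "d \<in> carrier_vec (vdim M j)" for j a d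
  proof -
    have "\<phi> j \<in> carrier_mat (vdim N (j + 1)) (vdim M j)" using \<phi> that(1) by simp
    from four_block_mat_mult_vec[OF N[OF that(1)] this zero_carrier_mat M[OF that(1)] that(2,3)]
    moreover have "arr M j *\<^sub>v d \<in> carrier_vec (vdim M (j + 1))" using M[OF that(1)] that(3) by simp
    ultimately show ?thesis
      unfolding X_def by (simp add: zero_mat_mult_vec[OF that(2)])
  qed
  have decomp: "w = vec_first w (vdim N j) @\<^sub>v vec_last w (vdim M j)"
    if "w \<in> carrier_vec (vdim X j)" for w :: "'k vec" and j
    using vec_first_last_append[of w] that by (simp add: X_def)
  have g_last: "g j *\<^sub>v w = vec_last w (vdim M j)" if "w \<in> carrier_vec (vdim X j)" for w j
  proof -
    have "g j *\<^sub>v w = g j *\<^sub>v (vec_first w (vdim N j) @\<^sub>v vec_last w (vdim M j))"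
      by (rule arg_cong[OF decomp[OF that]])
    also have "\<dots> = vec_last w (vdim M j)" by (rule gv[OF vec_first_carrier vec_last_carrier])
    finally show ?thesis .
  qed
  have "is_hom n N X f"
    unfolding is_hom_def
  proof (intro conjI ballI)
    fix j assume j: "j \<in> {1..<n}"
    show "f (j + 1) * arr N j = arr X j * f j"
    proof (rule mat_eq_on_vecI)
      fix v :: "'k vec" assume v: "v \<in> carrier_vec (vdim N j)"
      have Nv: "arr N j *\<^sub>v v \<in> carrier_vec (vdim N (j + 1))" using N[OF j] v by simp
      have \<phi>0: "\<phi> j *\<^sub>v 0\<^sub>v (vdim M j) = 0\<^sub>v (vdim N (j + 1))"
        using \<phi> j by (intro mat_mult_zero_vec) auto
      have M0: "arr M j *\<^sub>v 0\<^sub>v (vdim M j) = 0\<^sub>v (vdim M (j + 1))"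
        using M[OF j] by (intro mat_mult_zero_vec) auto
      have "(f (j + 1) * arr N j) *\<^sub>v v = (arr N j *\<^sub>v v) @\<^sub>v 0\<^sub>v (vdim M (j + 1))"
        using assoc_mult_mat_vec[OF f N[OF j] v] fv[OF Nv] by simp
      also have "\<dots> = (arr X j * f j) *\<^sub>v v"
        using assoc_mult_mat_vec[OF X[OF j] f v] fv[OF v] Xv[OF j v zero_carrier_vec] \<phi>0 M0 Nv
        by simp
      finally show "(f (j + 1) * arr N j) *\<^sub>v v = (arr X j * f j) *\<^sub>v v" .
    qed (use f[of j] f[of "j + 1"] N[OF j] X[OF j] in auto)
  qed (rule f)
  moreover have "is_hom n X M g"
    unfolding is_hom_def
  proof (intro conjI ballI)
    fix j assume j: "j \<in> {1..<n}"
    show "g (j + 1) * arr X j = arr M j * g j"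
    proof (rule mat_eq_on_vecI)
      fix w :: "'k vec" assume w: "w \<in> carrier_vec (vdim X j)"
      let ?a = "vec_first w (vdim N j)" and ?d = "vec_last w (vdim M j)"
      have c: "arr N j *\<^sub>v ?a + \<phi> j *\<^sub>v ?d \<in> carrier_vec (vdim N (j + 1))"
        "arr M j *\<^sub>v ?d \<in> carrier_vec (vdim M (j + 1))"
        using N[OF j] M[OF j] \<phi> j by (auto intro!: add_carrier_vec mult_mat_vec_carrier)
      have "(g (j + 1) * arr X j) *\<^sub>v w = g (j + 1) *\<^sub>v (arr X j *\<^sub>v w)"
        by (rule assoc_mult_mat_vec[OF g X[OF j] w])
      also have "arr X j *\<^sub>v w = arr X j *\<^sub>v (?a @\<^sub>v ?d)" by (rule arg_cong[OF decomp[OF w]])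
      also have "g (j + 1) *\<^sub>v \<dots> = arr M j *\<^sub>v ?d"
        unfolding Xv[OF j vec_first_carrier vec_last_carrier] by (rule gv[OF c])
      also have "\<dots> = (arr M j * g j) *\<^sub>v w"
        using assoc_mult_mat_vec[OF M[OF j] g w] g_last[OF w] by simp
      finally show "(g (j + 1) * arr X j) *\<^sub>v w = (arr M j * g j) *\<^sub>v w" .
    qed (use g[of j] g[of "j + 1"] M[OF j] X[OF j] in auto)
  qed (rule g)
  moreover have "inj_on (\<lambda>v. f j *\<^sub>v v) (carrier_vec (vdim N j)) \<and>
      (\<lambda>v. f j *\<^sub>v v) ` carrier_vec (vdim N j) = mat_kernel (g j) \<and>
      (\<lambda>v. g j *\<^sub>v v) ` carrier_vec (vdim X j) = carrier_vec (vdim M j)" for j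
  proof (intro conjI)
    show "inj_on (\<lambda>v. f j *\<^sub>v v) (carrier_vec (vdim N j))"
    proof (rule inj_onI)
      fix v w assume "v \<in> carrier_vec (vdim N j)" "w \<in> carrier_vec (vdim N j)"
        "f j *\<^sub>v v = f j *\<^sub>v w"
      then show "v = w" using append_vec_eq[of v "vdim N j" w] by (simp add: fv)
    qed
    show "(\<lambda>v. f j *\<^sub>v v) ` carrier_vec (vdim N j) = mat_kernel (g j)"
    proof (intro equalityI subsetI)
      fix w assume "w \<in> (\<lambda>v. f j *\<^sub>v v) ` carrier_vec (vdim N j)"
      then obtain v where v: "v \<in> carrier_vec (vdim N j)" "w = v @\<^sub>v 0\<^sub>v (vdim M j)"
        using fv by auto
      then have "w \<in> carrier_vec (vdim X j)" by (simp add: X_def)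
      then show "w \<in> mat_kernel (g j)"
        by (rule mat_kernelI[OF g]) (use v gv in simp)
    next
      fix w assume "w \<in> mat_kernel (g j)"
      then have w: "w \<in> carrier_vec (vdim X j)" "g j *\<^sub>v w = 0\<^sub>v (vdim M j)"
        using mat_kernelD[OF g] by auto
      let ?a = "vec_first w (vdim N j)" and ?d = "vec_last w (vdim M j)"
      have d: "?d = 0\<^sub>v (vdim M j)" using g_last[OF w(1)] w(2) by simp
      have "w = ?a @\<^sub>v ?d" by (rule decomp[OF w(1)])
      also have "\<dots> = f j *\<^sub>v ?a" unfolding d fv[OF vec_first_carrier] by (rule refl)
      finally have "w = f j *\<^sub>v ?a" .
      then show "w \<in> (\<lambda>v. f j *\<^sub>v v) ` carrier_vec (vdim N j)"
        by (rule image_eqI) (rule vec_first_carrier)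
    qed
    show "(\<lambda>v. g j *\<^sub>v v) ` carrier_vec (vdim X j) = carrier_vec (vdim M j)"
    proof (intro equalityI subsetI)
      fix d :: "'k vec" assume "d \<in> carrier_vec (vdim M j)"
      then have "d = g j *\<^sub>v (0\<^sub>v (vdim N j) @\<^sub>v d)" "0\<^sub>v (vdim N j) @\<^sub>v d \<in> carrier_vec (vdim X j)"
        using gv by (auto simp: X_def)
      then show "d \<in> (\<lambda>v. g j *\<^sub>v v) ` carrier_vec (vdim X j)" by (rule image_eqI)
    qed (use g[of j] mult_mat_vec_carrier in blast)
  qed
  ultimately have "short_exact n N f X g M"
    unfolding short_exact_def using repM repN X by (auto simp: is_rep_def)
  then obtain s where s: "is_hom n M X s" and gs: "\<And>j. j \<in> {1..n} \<Longrightarrow> g j * s j = 1\<^sub>m (vdim M j)"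
    using ext unfolding ext1_vanishes_def by blast
  have sc: "s j \<in> carrier_mat (vdim X j) (vdim M j)" if "j \<in> {1..n}" for j
    using s that by (simp add: is_hom_def)
  \<comment> \<open>Since \<open>g j * s j\<close> is the identity, the lower block of
    \<open>s j\<close> is known; \<open>u j\<close> consists of the first \<open>vdim N j\<close>
    rows.\<close>
  define u where "u j = mat (vdim N j) (vdim M j) (\<lambda>pq. s j $$ pq)" for j
  have u: "u j \<in> carrier_mat (vdim N j) (vdim M j)" for j by (simp add: u_def)
  have sv: "s j *\<^sub>v v = (u j *\<^sub>v v) @\<^sub>v v" if j: "j \<in> {1..n}" and v: "v \<in> carrier_vec (vdim M j)" for j v
  proof -
    have w: "s j *\<^sub>v v \<in> carrier_vec (vdim X j)" using sc[OF j] v by simp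
    have "vec_last (s j *\<^sub>v v) (vdim M j) = g j *\<^sub>v (s j *\<^sub>v v)"
      using g_last[OF w] by simp
    also have "\<dots> = v" using assoc_mult_mat_vec[OF g sc[OF j] v] gs[OF j] v by simp
    finally have l: "vec_last (s j *\<^sub>v v) (vdim M j) = v" .
    have f1: "vec_first (s j *\<^sub>v v) (vdim N j) = u j *\<^sub>v v"
    proof (rule eq_vecI)
      fix p assume "p < dim_vec (u j *\<^sub>v v)"
      then have p: "p < vdim N j" by (simp add: u_def)
      then have "row (s j) p = row (u j) p"
        using sc[OF j] by (intro eq_vecI) (auto simp: u_def X_def)
      then show "vec_first (s j *\<^sub>v v) (vdim N j) $ p = (u j *\<^sub>v v) $ p"
        using p sc[OF j] by (auto simp: vec_first_def u_def X_def)
    qed (simp add: u_def)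
    show ?thesis using decomp[OF w] unfolding l f1 .
  qed
  have "u (j + 1) * arr M j = arr N j * u j + \<phi> j" if j: "j \<in> {1..<n}" for j
  proof (rule mat_eq_on_vecI)
    have j1: "j \<in> {1..n}" "j + 1 \<in> {1..n}" using j by auto
    have \<phi>j: "\<phi> j \<in> carrier_mat (vdim N (j + 1)) (vdim M j)" using \<phi> j by simp
    show "u (j + 1) * arr M j \<in> carrier_mat (vdim N (j + 1)) (vdim M j)"
      "arr N j * u j + \<phi> j \<in> carrier_mat (vdim N (j + 1)) (vdim M j)"
      using u[of j] u[of "j + 1"] M[OF j] N[OF j] \<phi>j by auto
    fix v :: "'k vec" assume v: "v \<in> carrier_vec (vdim M j)"
    have Mv: "arr M j *\<^sub>v v \<in> carrier_vec (vdim M (j + 1))" using M[OF j] v by simp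
    have uv: "u j *\<^sub>v v \<in> carrier_vec (vdim N j)" using u[of j] v by simp
    have "s (j + 1) * arr M j = arr X j * s j" using s j by (simp add: is_hom_def)
    then have "s (j + 1) *\<^sub>v (arr M j *\<^sub>v v) = arr X j *\<^sub>v (s j *\<^sub>v v)"
      using assoc_mult_mat_vec[OF sc[OF j1(2)] M[OF j] v] assoc_mult_mat_vec[OF X[OF j] sc[OF j1(1)] v]
      by simp
    then have "(u (j + 1) *\<^sub>v (arr M j *\<^sub>v v)) @\<^sub>v (arr M j *\<^sub>v v) =
        (arr N j *\<^sub>v (u j *\<^sub>v v) + \<phi> j *\<^sub>v v) @\<^sub>v (arr M j *\<^sub>v v)"
      using sv[OF j1(2) Mv] sv[OF j1(1) v] Xv[OF j uv v] by simp
    moreover have "u (j + 1) *\<^sub>v (arr M j *\<^sub>v v) \<in> carrier_vec (vdim N (j + 1))"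
      "arr N j *\<^sub>v (u j *\<^sub>v v) + \<phi> j *\<^sub>v v \<in> carrier_vec (vdim N (j + 1))"
      using u[of "j + 1"] Mv N[OF j] uv \<phi>j v by auto
    ultimately have "u (j + 1) *\<^sub>v (arr M j *\<^sub>v v) = arr N j *\<^sub>v (u j *\<^sub>v v) + \<phi> j *\<^sub>v v"
      using append_vec_eq by blast
    then show "(u (j + 1) * arr M j) *\<^sub>v v = (arr N j * u j + \<phi> j) *\<^sub>v v"
      using assoc_mult_mat_vec[OF u M[OF j] v] assoc_mult_mat_vec[OF N[OF j] u v]
        add_mult_distrib_mat_vec[OF mult_carrier_mat[OF N[OF j] u] \<phi>j v] by simp
  qed
  then show "\<exists>u. (\<forall>j\<in>{1..n}. u j \<in> carrier_mat (vdim N j) (vdim M j)) \<and>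
      (\<forall>j\<in>{1..<n}. u (j + 1) * arr M j = arr N j * u j + \<phi> j)"
    using u by blast
qed


section \<open>Interval modules\<close>

text \<open>Nonzero scalars in place of identity maps: this describes all representations isomorphic
  to \<open>M_ab\<close>, so bases never have to be rescaled.\<close>

definition interval_module :: "nat \<Rightarrow> 'k::field qrep \<Rightarrow> nat \<Rightarrow> nat \<Rightarrow> bool" where
  "interval_module n V a b \<longleftrightarrow> is_rep n V \<and> 1 \<le> a \<and> a \<le> b \<and> b \<le> n \<and>
     (\<forall>j\<in>{1..n}. vdim V j = (if a \<le> j \<and> j \<le> b then 1 else 0)) \<and>
     (\<forall>j\<in>{a..<b}. arr V j $$ (0, 0) \<noteq> 0)"

lemma interval_moduleD:
  assumes "interval_module n V a b"
  shows "is_rep n V" "1 \<le> a" "a \<le> b" "b \<le> n"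
    and "1 \<le> j \<Longrightarrow> j \<le> n \<Longrightarrow> vdim V j = (if a \<le> j \<and> j \<le> b then 1 else 0)"
    and "a \<le> j \<Longrightarrow> j < b \<Longrightarrow> arr V j $$ (0, 0) \<noteq> 0"
    and "1 \<le> j \<Longrightarrow> j < n \<Longrightarrow> arr V j \<in> carrier_mat (vdim V (j + 1)) (vdim V j)"
proof -
  show rep: "is_rep n V" using assms by (simp add: interval_module_def)
  show "1 \<le> j \<Longrightarrow> j < n \<Longrightarrow> arr V j \<in> carrier_mat (vdim V (j + 1)) (vdim V j)"
    using rep unfolding is_rep_def by simp
qed (use assms in \<open>simp_all add: interval_module_def\<close>)

lemma supp_interval_module:
  assumes "interval_module n V a b" shows "supp n V = {a..b}"
proof (rule Set.set_eqI)
  fix j show "j \<in> supp n V \<longleftrightarrow> j \<in> {a..b}"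
    using interval_moduleD(2-4)[OF assms] interval_moduleD(5)[OF assms, of j]
    by (cases "1 \<le> j \<and> j \<le> n") (simp_all add: supp_def, linarith)
qed

lemma interval_module_exists:
  assumes "1 \<le> a" "a \<le> b" "b \<le> n"
  obtains V :: "'k::field qrep" where "interval_module n V a b"
proof -
  let ?d = "\<lambda>j. if a \<le> j \<and> j \<le> b then 1 else 0 :: nat"
  let ?V = "\<lparr>vdim = ?d, arr = \<lambda>j. mat (?d (j + 1)) (?d j) (\<lambda>_. 1)\<rparr> :: 'k qrep"
  have "interval_module n ?V a b"
    using assms by (auto simp: interval_module_def is_rep_def)
  then show ?thesis using that by blast
qed

section \<open>Scalar equations for spaces of dimension at most one\<close>

lemma mat_eq_small:
  assumes "A \<in> carrier_mat r c" "B \<in> carrier_mat r c" "r \<le> 1" "c \<le> 1"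
    and "r = 1 \<Longrightarrow> c = 1 \<Longrightarrow> A $$ (0, 0) = B $$ (0, 0)"
  shows "A = B"
proof (rule eq_matI)
  fix i j assume "i < dim_row B" "j < dim_col B"
  then have "i < r" "j < c" using assms(2) by auto
  then have "i = 0" "j = 0" "r = 1" "c = 1" using assms(3,4) by auto
  then show "A $$ (i, j) = B $$ (i, j)" using assms(5) by simp
qed (use assms(1,2) in auto)

text \<open>The inner dimension is 0 when the path through the middle vertex leaves a support, and
  the composite is then zero. This is the origin of the \<open>if\<close> terms in the equations
  below.\<close>

lemma mult_mat_small:
  fixes A B :: "'a :: semiring_0 mat"
  assumes "A \<in> carrier_mat 1 k" "B \<in> carrier_mat k 1" "k \<le> 1"
  shows "(A * B) $$ (0, 0) = (if k = 1 then A $$ (0, 0) * B $$ (0, 0) else 0)"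
proof -
  have "(A * B) $$ (0, 0) = (\<Sum>i\<in>{0..<k}. A $$ (0, i) * B $$ (i, 0))"
    using assms by (simp add: scalar_prod_def)
  also have "k = 0 \<or> k = 1" using assms(3) by auto
  then have "(\<Sum>i\<in>{0..<k}. A $$ (0, i) * B $$ (i, 0)) = (if k = 1 then A $$ (0, 0) * B $$ (0, 0) else 0)"
    by auto
  finally show ?thesis .
qed

locale interval_module_pair =
  fixes n :: nat and V W :: "'k::field qrep" and a b c d :: nat
  assumes V: "interval_module n V a b" and W: "interval_module n W c d"
begin

lemmas VD = interval_moduleD[OF V] and WD = interval_moduleD[OF W]

lemma entry_left:
  assumes j: "a \<le> j" "j \<le> b" "c \<le> j + 1" "j + 1 \<le> d"
    and f: "f (j + 1) \<in> carrier_mat (vdim W (j + 1)) (vdim V (j + 1))"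
  shows "(f (j + 1) * arr V j) $$ (0, 0) =
    (if j + 1 \<le> b then f (j + 1) $$ (0, 0) * arr V j $$ (0, 0) else 0)"
proof -
  have jn: "1 \<le> j" "j < n" using j VD(2) WD(4) by auto
  have dims: "vdim V j = 1" "vdim W (j + 1) = 1" "vdim V (j + 1) = (if j + 1 \<le> b then 1 else 0)"
    using VD(5)[of j] VD(5)[of "j + 1"] WD(5)[of "j + 1"] jn j by auto
  show ?thesis
    using mult_mat_small[of "f (j + 1)" "vdim V (j + 1)" "arr V j"] f VD(7)[OF jn]
    unfolding dims by auto
qed

lemma entry_right:
  assumes j: "a \<le> j" "j \<le> b" "c \<le> j + 1" "j + 1 \<le> d"
    and f: "f j \<in> carrier_mat (vdim W j) (vdim V j)"
  shows "(arr W j * f j) $$ (0, 0) = (if c \<le> j then arr W j $$ (0, 0) * f j $$ (0, 0) else 0)"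
proof -
  have jn: "1 \<le> j" "j < n" using j VD(2) WD(4) by auto
  have dims: "vdim V j = 1" "vdim W (j + 1) = 1" "vdim W j = (if c \<le> j then 1 else 0)"
    using VD(5)[of j] WD(5)[of j] WD(5)[of "j + 1"] jn j by auto
  show ?thesis
    using mult_mat_small[of "arr W j" "vdim W j" "f j"] f WD(7)[OF jn]
    unfolding dims by auto
qed

text \<open>A square whose source or target space is zero commutes automatically, so only arrows
  from a vertex of \<open>[a, b]\<close> into \<open>[c, d]\<close> give conditions.\<close>

lemma square_eqI:
  assumes j: "1 \<le> j" "j < n"
    and AB: "A \<in> carrier_mat (vdim W (j + 1)) (vdim V j)" "B \<in> carrier_mat (vdim W (j + 1)) (vdim V j)"
    and eq: "a \<le> j \<Longrightarrow> j \<le> b \<Longrightarrow> c \<le> j + 1 \<Longrightarrow> j + 1 \<le> d \<Longrightarrow> A $$ (0, 0) = B $$ (0, 0)"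
  shows "A = B"
proof (rule mat_eq_small[OF AB])
  have dims: "vdim V j = (if a \<le> j \<and> j \<le> b then 1 else 0)"
    "vdim W (j + 1) = (if c \<le> j + 1 \<and> j + 1 \<le> d then 1 else 0)"
    using VD(5)[of j] WD(5)[of "j + 1"] j by auto
  then show "vdim W (j + 1) \<le> 1" "vdim V j \<le> 1" by simp_all
  assume "vdim W (j + 1) = 1" "vdim V j = 1"
  then have "a \<le> j \<and> j \<le> b" "c \<le> j + 1 \<and> j + 1 \<le> d" using dims by (metis zero_neq_one)+
  then show "A $$ (0, 0) = B $$ (0, 0)" using eq by simp
qed

section \<open>Homomorphisms between interval modules\<close>

lemma hom_entries:
  assumes f: "is_hom n V W f" and j: "a \<le> j" "j \<le> b" "c \<le> j + 1" "j + 1 \<le> d"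
  shows "(if j + 1 \<le> b then f (j + 1) $$ (0, 0) * arr V j $$ (0, 0) else 0) =
    (if c \<le> j then arr W j $$ (0, 0) * f j $$ (0, 0) else 0)"
proof -
  have jn: "1 \<le> j" "j < n" using j VD(2) WD(4) by auto
  have "f (j + 1) * arr V j = arr W j * f j" "f j \<in> carrier_mat (vdim W j) (vdim V j)"
    "f (j + 1) \<in> carrier_mat (vdim W (j + 1)) (vdim V (j + 1))"
    using f jn by (auto simp: is_hom_def)
  then show ?thesis using entry_left[of j f] entry_right[of j f] j by simp
qed

text \<open>\<open>W\<close> is zero just before \<open>c\<close> whereas \<open>V\<close> is not,
  so the square there kills \<open>f c\<close>; the invertible arrows of \<open>V\<close> carry the
  zero to the right.\<close>

lemma hom_zero_left:
  assumes f: "is_hom n V W f" and "a < c" "c \<le> j" "j \<le> b" "j \<le> d"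
  shows "f j $$ (0, 0) = 0"
  using assms(3-)
proof (induction j rule: dec_induct)
  case base
  obtain m where "c = Suc m" using assms(2) by (cases c) auto
  then show ?case using base hom_entries[OF f, of m] VD(6)[of m] assms(2) by auto
next
  case (step m)
  then show ?case using hom_entries[OF f, of m] VD(6)[of m] assms(2) by auto
qed

text \<open>Mirror argument: \<open>V\<close> is zero just after \<open>b\<close> whereas
  \<open>W\<close> continues, so the square there kills \<open>f b\<close>, and the zero travels to
  the left.\<close>

lemma hom_zero_right:
  assumes f: "is_hom n V W f" and "b < d" "j \<le> b" "a \<le> j" "c \<le> j"
  shows "f j $$ (0, 0) = 0"
  using assms(3-)
proof (induction j rule: inc_induct)
  case base
  then show ?case using hom_entries[OF f, of b] WD(6)[of b] assms(2) by auto
next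
  case (step m)
  then show ?case using hom_entries[OF f, of m] WD(6)[of m] assms(2) by auto
qed

text \<open>Quotients of \<open>V\<close> live on initial segments of \<open>[a, b]\<close> and
  submodules of \<open>W\<close> on final segments of \<open>[c, d]\<close>, so the image of a
  nonzero map can only be supported on \<open>[a, d]\<close>.\<close>

lemma hom_vanishes_iff: "hom_vanishes n V W \<longleftrightarrow> \<not> (c \<le> a \<and> a \<le> d \<and> d \<le> b)"
proof
  assume van: "hom_vanishes n V W"
  show "\<not> (c \<le> a \<and> a \<le> d \<and> d \<le> b)"
  proof
    assume ord: "c \<le> a \<and> a \<le> d \<and> d \<le> b"
    \<comment> \<open>The scalar solution of the commutation equations with value 1 at
      \<open>a\<close>, where the product is empty.\<close>
    define h where "h j = (\<Prod>k\<in>{a..<j}. arr W k $$ (0, 0) / arr V k $$ (0, 0))" for j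
    define f where "f j = mat (vdim W j) (vdim V j) (\<lambda>_. h j)" for j
    have fc: "f j \<in> carrier_mat (vdim W j) (vdim V j)" for j by (simp add: f_def)
    have "is_hom n V W f"
      unfolding is_hom_def
    proof (intro conjI ballI)
      fix j assume "j \<in> {1..<n}"
      then have jn: "1 \<le> j" "j < n" by auto
      show "f (j + 1) * arr V j = arr W j * f j"
      proof (rule square_eqI[OF jn])
        assume j: "a \<le> j" "j \<le> b" "c \<le> j + 1" "j + 1 \<le> d"
        have "f j $$ (0, 0) = h j" "f (j + 1) $$ (0, 0) = h (j + 1)"
          using VD(5)[of j] WD(5)[of j] VD(5)[of "j + 1"] WD(5)[of "j + 1"] jn j ord
          by (auto simp: f_def)
        moreover have "h (j + 1) * arr V j $$ (0, 0) = arr W j $$ (0, 0) * h j"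
          using VD(6)[of j] j ord by (simp add: h_def)
        ultimately show "(f (j + 1) * arr V j) $$ (0, 0) = (arr W j * f j) $$ (0, 0)"
          using entry_left[of j f, OF j] entry_right[of j f, OF j] fc j ord by simp
      qed (use fc[of j] fc[of "j + 1"] VD(7)[OF jn] WD(7)[OF jn] in auto)
    qed (rule fc)
    then have fa: "f a = 0\<^sub>m (vdim W a) (vdim V a)"
      using van VD(2,3,4) unfolding hom_vanishes_def by simp
    have dims: "vdim W a = 1" "vdim V a = 1" using VD(2-4) VD(5)[of a] WD(5)[of a] ord by auto
    have "f a $$ (0, 0) = h a" using dims by (simp add: f_def)
    moreover have "f a $$ (0, 0) = 0" unfolding fa using dims by simp
    ultimately have "h a = 0" by simp
    then show False by (simp add: h_def)
  qed
next
  assume nord: "\<not> (c \<le> a \<and> a \<le> d \<and> d \<le> b)"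
  show "hom_vanishes n V W"
    unfolding hom_vanishes_def
  proof (intro allI impI ballI)
    fix f j assume f: "is_hom n V W f" and j: "j \<in> {1..n}"
    have dims: "vdim V j = (if a \<le> j \<and> j \<le> b then 1 else 0)"
      "vdim W j = (if c \<le> j \<and> j \<le> d then 1 else 0)" using VD(5)[of j] WD(5)[of j] j by auto
    show "f j = 0\<^sub>m (vdim W j) (vdim V j)"
    proof (rule mat_eq_small)
      show "f j \<in> carrier_mat (vdim W j) (vdim V j)" using f j by (simp add: is_hom_def)
      assume "vdim W j = 1" "vdim V j = 1"
      then have "a \<le> j \<and> j \<le> b" "c \<le> j \<and> j \<le> d" using dims by (metis zero_neq_one)+
      then have jj: "a \<le> j" "j \<le> b" "c \<le> j" "j \<le> d" by auto
      consider "a < c" | "b < d" using nord jj by linarith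
      then have "f j $$ (0, 0) = 0"
        using hom_zero_left[OF f _ jj(3,2,4)] hom_zero_right[OF f _ jj(2,1,3)] by cases simp_all
      then show "f j $$ (0, 0) = 0\<^sub>m (vdim W j) (vdim V j) $$ (0, 0)"
        using dims jj by simp
    qed (use dims in auto)
  qed
qed

section \<open>Extensions between interval modules\<close>

lemma coboundary_entries:
  assumes u: "u j \<in> carrier_mat (vdim W j) (vdim V j)"
    "u (j + 1) \<in> carrier_mat (vdim W (j + 1)) (vdim V (j + 1))"
    and p: "p \<in> carrier_mat (vdim W (j + 1)) (vdim V j)"
    and j: "a \<le> j" "j \<le> b" "c \<le> j + 1" "j + 1 \<le> d"
  shows "u (j + 1) * arr V j = arr W j * u j + p \<longleftrightarrow>
    (if j + 1 \<le> b then u (j + 1) $$ (0, 0) * arr V j $$ (0, 0) else 0) =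
    (if c \<le> j then arr W j $$ (0, 0) * u j $$ (0, 0) else 0) + p $$ (0, 0)"
proof -
  have jn: "1 \<le> j" "j < n" using j VD(2) WD(4) by auto
  have dims: "vdim V j = 1" "vdim W (j + 1) = 1"
    using VD(5)[of j] WD(5)[of "j + 1"] jn j by auto
  have sum: "(arr W j * u j + p) $$ (0, 0) = (arr W j * u j) $$ (0, 0) + p $$ (0, 0)"
    using p dims by simp
  have "u (j + 1) * arr V j = arr W j * u j + p \<longleftrightarrow>
      (u (j + 1) * arr V j) $$ (0, 0) = (arr W j * u j + p) $$ (0, 0)" (is "?l \<longleftrightarrow> ?r")
  proof
    show ?l if ?r
      by (rule square_eqI[OF jn _ _ that])
        (use u p VD(7)[OF jn] WD(7)[OF jn] in auto)
  qed simp
  then show ?thesis using entry_left[of j u, OF j] entry_right[of j u, OF j] u sum by simp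
qed

text \<open>The unknowns sit at the vertices common to both supports, the equations at the arrows
  from \<open>[a, b]\<close> into \<open>[c, d]\<close>. In the excluded position the unknowns run
  over \<open>[c, b]\<close> but the equations over \<open>[c - 1, b]\<close>: one equation too
  many. Otherwise there are no equations, or they can be solved from one end.\<close>

lemma coboundaries_full_iff:
  "coboundaries_full n V W \<longleftrightarrow> \<not> (a < c \<and> c \<le> b + 1 \<and> b + 1 \<le> d)"
proof
  assume full: "coboundaries_full n V W"
  show "\<not> (a < c \<and> c \<le> b + 1 \<and> b + 1 \<le> d)"
  proof
    assume ord: "a < c \<and> c \<le> b + 1 \<and> b + 1 \<le> d"
    \<comment> \<open>A cochain supported at the arrow leaving \<open>b\<close>. The equation there
      forces \<open>u b\<close> to be nonzero, this spreads down to \<open>c\<close>, and the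
      equation at \<open>c - 1\<close> forces \<open>u c\<close> to be zero. For
      \<open>c = b + 1\<close> the first equation already reads \<open>0 = 1\<close>.\<close>
    define p where "p j = mat (vdim W (j + 1)) (vdim V j) (\<lambda>_. if j = b then 1 else 0 :: 'k)" for j
    have pc: "p j \<in> carrier_mat (vdim W (j + 1)) (vdim V j)" for j by (simp add: p_def)
    then obtain u where u: "\<forall>j\<in>{1..n}. u j \<in> carrier_mat (vdim W j) (vdim V j)"
      "\<forall>j\<in>{1..<n}. u (j + 1) * arr V j = arr W j * u j + p j"
      using full unfolding coboundaries_full_def by blast
    have eq: "(if j + 1 \<le> b then u (j + 1) $$ (0, 0) * arr V j $$ (0, 0) else 0) =
      (if c \<le> j then arr W j $$ (0, 0) * u j $$ (0, 0) else 0) + (if j = b then 1 else 0)"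
      if j: "a \<le> j" "j \<le> b" "c \<le> j + 1" "j + 1 \<le> d" for j
    proof -
      have jn: "1 \<le> j" "j < n" using j VD(2) WD(4) by auto
      have "p j $$ (0, 0) = (if j = b then 1 else 0)"
        using VD(5)[of j] WD(5)[of "j + 1"] jn j by (auto simp: p_def)
      moreover have uc: "u j \<in> carrier_mat (vdim W j) (vdim V j)"
        "u (j + 1) \<in> carrier_mat (vdim W (j + 1)) (vdim V (j + 1))"
        and "u (j + 1) * arr V j = arr W j * u j + p j" using u jn by auto
      ultimately show ?thesis using coboundary_entries[OF uc pc j] by simp
    qed
    have "c \<le> b" using eq[of b] ord VD(3) by (cases "c \<le> b") auto
    have nz: "u j $$ (0, 0) \<noteq> 0" if "j \<le> b" "c \<le> j" for j
      using that
    proof (induction j rule: inc_induct)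
      case base
      then show ?case using eq[of b] ord VD(3) by auto
    next
      case (step m)
      then show ?case using eq[of m] VD(6)[of m] ord by auto
    qed
    obtain m where "c = Suc m" using ord by (cases c) auto
    then show False using eq[of m] nz[of c] VD(6)[of m] ord \<open>c \<le> b\<close> by auto
  qed
next
  assume nord: "\<not> (a < c \<and> c \<le> b + 1 \<and> b + 1 \<le> d)"
  show "coboundaries_full n V W"
    unfolding coboundaries_full_def
  proof (intro allI impI)
    fix p :: "nat \<Rightarrow> 'k mat"
    assume pc: "\<forall>j\<in>{1..<n}. p j \<in> carrier_mat (vdim W (j + 1)) (vdim V j)"
    have "\<exists>h :: nat \<Rightarrow> 'k. \<forall>j. a \<le> j \<longrightarrow> j \<le> b \<longrightarrow> c \<le> j + 1 \<longrightarrow> j + 1 \<le> d \<longrightarrow>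
      (if j + 1 \<le> b then h (j + 1) * arr V j $$ (0, 0) else 0) =
      (if c \<le> j then arr W j $$ (0, 0) * h j else 0) + p j $$ (0, 0)"
    proof -
      consider "c \<le> a" | "d \<le> b" | "b + 1 < c" using nord by linarith
      then show ?thesis
      proof cases
        case 1
        \<comment> \<open>The entry of \<open>arr W j\<close> is nonzero in every equation, so
          \<open>u j\<close> is computed from \<open>u (j + 1)\<close>, downwards from the free
          value 0 at \<open>d\<close>.\<close>
        define G where "G j x = ((if j + 1 \<le> b then x * arr V j $$ (0, 0) else 0) - p j $$ (0, 0)) /
          arr W j $$ (0, 0)" for j x
        define h where "h j = rec_nat 0 (\<lambda>k x. G (d - Suc k) x) (d - j)" for j
        have h: "h j = G j (h (j + 1))" if "j < d" for j
        proof -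
          have *: "d - j = Suc (d - (j + 1))" using that by simp
          have "h j = G (d - Suc (d - (j + 1))) (h (j + 1))" unfolding h_def * by simp
          then show ?thesis using that by simp
        qed
        have "arr W j $$ (0, 0) * h j =
          (if j + 1 \<le> b then h (j + 1) * arr V j $$ (0, 0) else 0) - p j $$ (0, 0)"
          if "a \<le> j" "j + 1 \<le> d" for j
          using h[of j] WD(6)[of j] 1 that by (simp add: G_def)
        then show ?thesis using 1 by (intro exI[of _ h]) auto
      next
        case 2
        \<comment> \<open>The entry of \<open>arr V j\<close> is nonzero in every equation, so the
          recurrence runs upwards, from the free value 0 at index 0.\<close>
        define G where "G j x = ((if c \<le> j then arr W j $$ (0, 0) * x else 0) + p j $$ (0, 0)) /
          arr V j $$ (0, 0)" for j x
        define h where "h j = rec_nat 0 G j" for j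
        have "h (j + 1) * arr V j $$ (0, 0) =
          (if c \<le> j then arr W j $$ (0, 0) * h j else 0) + p j $$ (0, 0)"
          if "a \<le> j" "j + 1 \<le> d" for j
          using VD(6)[of j] 2 that by (simp add: G_def h_def)
        then show ?thesis using 2 by (intro exI[of _ h]) auto
      next
        case 3
        then show ?thesis by auto
      qed
    qed
    then obtain h :: "nat \<Rightarrow> 'k" where h: "\<And>j. a \<le> j \<Longrightarrow> j \<le> b \<Longrightarrow> c \<le> j + 1 \<Longrightarrow> j + 1 \<le> d \<Longrightarrow>
      (if j + 1 \<le> b then h (j + 1) * arr V j $$ (0, 0) else 0) =
      (if c \<le> j then arr W j $$ (0, 0) * h j else 0) + p j $$ (0, 0)" by blast
    define u where "u j = mat (vdim W j) (vdim V j) (\<lambda>_. h j)" for j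
    have uc: "u j \<in> carrier_mat (vdim W j) (vdim V j)" for j by (simp add: u_def)
    have "u (j + 1) * arr V j = arr W j * u j + p j" if "j \<in> {1..<n}" for j
    proof -
      have jn: "1 \<le> j" "j < n" using that by auto
      have pj: "p j \<in> carrier_mat (vdim W (j + 1)) (vdim V j)" using pc that by simp
      show ?thesis
      proof (cases "a \<le> j \<and> j \<le> b \<and> c \<le> j + 1 \<and> j + 1 \<le> d")
        case True
        then have j: "a \<le> j" "j \<le> b" "c \<le> j + 1" "j + 1 \<le> d" by auto
        have "c \<le> j \<Longrightarrow> u j $$ (0, 0) = h j" "j + 1 \<le> b \<Longrightarrow> u (j + 1) $$ (0, 0) = h (j + 1)"
          using VD(5)[of j] WD(5)[of j] VD(5)[of "j + 1"] WD(5)[of "j + 1"] jn j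
          by (auto simp: u_def)
        then show ?thesis using h[OF j] by (subst coboundary_entries[OF uc uc pj j]) auto
      next
        case False
        show ?thesis
          by (rule square_eqI[OF jn])
            (use False pj uc[of j] uc[of "j + 1"] VD(7)[OF jn] WD(7)[OF jn] in auto)
      qed
    qed
    then show "\<exists>u. (\<forall>j\<in>{1..n}. u j \<in> carrier_mat (vdim W j) (vdim V j)) \<and>
        (\<forall>j\<in>{1..<n}. u (j + 1) * arr V j = arr W j * u j + p j)"
      using uc by blast
  qed
qed

lemma ext1_vanishes_iff: "ext1_vanishes n V W \<longleftrightarrow> \<not> (a < c \<and> c \<le> b + 1 \<and> b + 1 \<le> d)"
proof -
  have "ext1_vanishes n V W \<longleftrightarrow> coboundaries_full n V W"
    by (rule iffI[OF coboundaries_full_if_ext1_vanishes[OF VD(1) WD(1)]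
          ext1_vanishes_if_coboundaries_full])
  then show ?thesis using coboundaries_full_iff by simp
qed

end


section \<open>Indecomposable representations\<close>

lemma subspaceI:
  fixes U :: "'k::field vec set"
  assumes "U \<subseteq> carrier_vec m" "0\<^sub>v m \<in> U"
    and "\<And>v w. v \<in> U \<Longrightarrow> w \<in> U \<Longrightarrow> v + w \<in> U"
    and "\<And>c v. v \<in> U \<Longrightarrow> c \<cdot>\<^sub>v v \<in> U"
  shows "subspace class_ring U (module_vec TYPE('k) m)"
proof -
  have "submodule class_ring U (module_vec TYPE('k) m)"
    unfolding submodule_def using vec_module assms by (simp add: module_vec_simps)
  then show ?thesis unfolding subspace_def using vec_vs by blast
qed

lemma subspaceD:
  fixes U :: "'k::field vec set"
  assumes "subspace class_ring U (module_vec TYPE('k) m)"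
  shows "U \<subseteq> carrier_vec m" "0\<^sub>v m \<in> U" "v \<in> U \<Longrightarrow> c \<cdot>\<^sub>v v \<in> U"
proof -
  have "submodule class_ring U (module_vec TYPE('k) m)"
    using assms by (simp add: subspace_def)
  then show "U \<subseteq> carrier_vec m" "0\<^sub>v m \<in> U" "v \<in> U \<Longrightarrow> c \<cdot>\<^sub>v v \<in> U"
    unfolding submodule_def by (auto simp: module_vec_simps)
qed

lemma nonzero_vec_entry:
  assumes "v \<in> carrier_vec m" "v \<noteq> 0\<^sub>v m"
  obtains k where "k < m" "v $ k \<noteq> 0"
proof -
  have "\<exists>k<m. v $ k \<noteq> 0"
  proof (rule ccontr)
    assume "\<not> (\<exists>k<m. v $ k \<noteq> 0)"
    then have "v = 0\<^sub>v m" using assms(1) by (intro eq_vecI) auto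
    then show False using assms(2) by simp
  qed
  then show ?thesis using that by blast
qed

lemma carrier_vec_zero_iff: "carrier_vec m = {0\<^sub>v m :: 'k::field vec} \<longleftrightarrow> m = 0"
proof
  assume eq: "carrier_vec m = {0\<^sub>v m :: 'k vec}"
  show "m = 0"
  proof (rule ccontr)
    assume "m \<noteq> 0"
    moreover have "unit_vec m 0 \<in> (carrier_vec m :: 'k vec set)" by simp
    then have "unit_vec m 0 = (0\<^sub>v m :: 'k vec)" unfolding eq by simp
    then have "unit_vec m 0 $ 0 = (0\<^sub>v m :: 'k vec) $ 0" by simp
    ultimately show False by simp
  qed
qed auto

lemma dim_eq_1_if_carrier_multiples:
  fixes x :: "'k::field vec"
  assumes x: "x \<in> carrier_vec m" "x \<noteq> 0\<^sub>v m" and car: "carrier_vec m \<subseteq> range (\<lambda>c. c \<cdot>\<^sub>v x)"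
  shows "m = 1"
proof (rule ccontr)
  assume "m \<noteq> 1"
  obtain k where k: "k < m" "x $ k \<noteq> 0" using nonzero_vec_entry[OF x] by blast
  obtain q where q: "q < m" "q \<noteq> k"
  proof (cases "k = 0")
    case True
    then show ?thesis using that[of 1] k \<open>m \<noteq> 1\<close> by simp
  next
    case False
    then show ?thesis using that[of 0] k by simp
  qed
  have "unit_vec m q \<in> (carrier_vec m :: 'k vec set)" by simp
  then obtain c where c: "unit_vec m q = c \<cdot>\<^sub>v x" using car by blast
  have "(c \<cdot>\<^sub>v x) $ k = 0" unfolding c[symmetric] using k q by simp
  then have "c = 0" using k x by simp
  moreover have "(c \<cdot>\<^sub>v x) $ q = 1" unfolding c[symmetric] using q by simp
  ultimately show False using q x by simp
qed

text \<open>The nonzero arrows push every nonzero subrepresentation to the last vertex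
  \<open>b\<close>. The space there is a line, so two such subrepresentations meet.\<close>

lemma indecomposable_interval_module:
  fixes V :: "'k::field qrep"
  assumes V: "interval_module n V a b"
  shows "indecomposable n V"
proof -
  note VD = interval_moduleD[OF V]
  have b: "b \<in> {1..n}" "vdim V b = 1" using VD(2-4) VD(5)[of b] by auto
  have top: "\<exists>u\<in>U b. u $ 0 \<noteq> 0" if U: "nonzero_subrep n V U" for U
  proof -
    obtain j where j: "j \<in> {1..n}" "U j \<noteq> {0\<^sub>v (vdim V j)}"
      and sub: "\<And>j. j \<in> {1..n} \<Longrightarrow> subspace class_ring (U j) (module_vec TYPE('k) (vdim V j))"
      and arr: "\<And>j u. j \<in> {1..<n} \<Longrightarrow> u \<in> U j \<Longrightarrow> arr V j *\<^sub>v u \<in> U (j + 1)"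
      using U unfolding nonzero_subrep_def subrep_def by blast
    obtain u where u: "u \<in> U j" "u \<noteq> 0\<^sub>v (vdim V j)" using j subspaceD(2)[OF sub[OF j(1)]] by blast
    then have uc: "u \<in> carrier_vec (vdim V j)" using subspaceD(1)[OF sub[OF j(1)]] by blast
    obtain k where k: "k < vdim V j" "u $ k \<noteq> 0" using nonzero_vec_entry[OF uc u(2)] by blast
    have vj: "vdim V j = (if a \<le> j \<and> j \<le> b then 1 else 0)" using VD(5)[of j] j by simp
    then have jab: "a \<le> j" "j \<le> b" and "k = 0" using k(1) by (auto split: if_splits)
    have "\<exists>u\<in>U i. u $ 0 \<noteq> 0" if "j \<le> i" "i \<le> b" for i
      using that
    proof (induction i rule: dec_induct)
      case base
      then show ?case using u k \<open>k = 0\<close> by blast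
    next
      case (step m)
      then obtain u where u: "u \<in> U m" "u $ 0 \<noteq> 0" by auto
      have m: "1 \<le> m" "m < n" "a \<le> m" "m < b" using step jab VD(2,4) by auto
      have dims: "vdim V m = 1" "vdim V (m + 1) = 1" using VD(5)[of m] VD(5)[of "m + 1"] m VD(4) by auto
      have uc: "u \<in> carrier_vec 1" using subspaceD(1)[OF sub[of m]] u dims m by auto
      have A: "arr V m \<in> carrier_mat 1 1" using VD(7)[OF m(1,2)] dims by simp
      have "(arr V m *\<^sub>v u) $ 0 = arr V m $$ (0, 0) * u $ 0"
        using A uc by (simp add: scalar_prod_def)
      then have "(arr V m *\<^sub>v u) $ 0 \<noteq> 0" using VD(6)[OF m(3,4)] u(2) by simp
      then show ?case using arr[of m u] m u by auto
    qed
    then show ?thesis using jab by blast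
  qed
  have "\<not> (nonzero_subrep n V U \<and> nonzero_subrep n V W \<and> is_direct_sum n V U W)" for U W
  proof
    assume UW: "nonzero_subrep n V U \<and> nonzero_subrep n V W \<and> is_direct_sum n V U W"
    then have sub: "subspace class_ring (U b) (module_vec TYPE('k) 1)"
      "subspace class_ring (W b) (module_vec TYPE('k) 1)"
      using b unfolding nonzero_subrep_def subrep_def by metis+
    obtain u w where uw: "u \<in> U b" "u $ 0 \<noteq> 0" "w \<in> W b" "w $ 0 \<noteq> 0" using UW top by blast
    then have c: "u \<in> carrier_vec 1" "w \<in> carrier_vec 1"
      using subspaceD(1)[OF sub(1)] subspaceD(1)[OF sub(2)] by auto
    have "w = (w $ 0 / u $ 0) \<cdot>\<^sub>v u" using c uw by (intro eq_vecI) auto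
    then have "w \<in> U b" using subspaceD(3)[OF sub(1) uw(1)] by metis
    moreover have "U b \<inter> W b = {0\<^sub>v 1}" using UW b unfolding is_direct_sum_def by metis
    ultimately have "w = 0\<^sub>v 1" using uw by blast
    then show False using uw by simp
  qed
  then show ?thesis unfolding indecomposable_def using VD(1) b by (metis zero_neq_one)
qed

text \<open>The vectors \<open>x j\<close> are the images of a vector at the first vertex \<open>a\<close> of the support,
  \<open>b\<close> is the last vertex where the image is nonzero, and the linear forms
  \<open>v \<mapsto> (P j *\<^sub>v v) $ k\<close> are compatible with the arrows. As nothing is mapped to the space at \<open>a\<close>,
  the kernels of the forms complement the interval module spanned by the \<open>x j\<close>.\<close>

lemma interval_module_if_indecomposable:
  fixes V :: "'k::field qrep"
  assumes ind: "indecomposable n V"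
  obtains a b where "interval_module n V a b"
proof -
  have rep: "is_rep n V" and ex: "\<exists>j. j \<in> {1..n} \<and> vdim V j \<noteq> 0"
    using ind by (auto simp: indecomposable_def)
  have A: "arr V j \<in> carrier_mat (vdim V (j + 1)) (vdim V j)" if "1 \<le> j" "j < n" for j
    using rep that by (simp add: is_rep_def)
  define a where "a = (LEAST j. j \<in> {1..n} \<and> vdim V j \<noteq> 0)"
  have a: "1 \<le> a" "a \<le> n" "vdim V a \<noteq> 0" using LeastI_ex[OF ex] by (auto simp: a_def)
  have below: "vdim V j = 0" if "1 \<le> j" "j < a" for j
    using not_less_Least[of j] that a(2) unfolding a_def by fastforce
  define x :: "nat \<Rightarrow> 'k vec" where
    "x j = rec_nat (unit_vec (vdim V a) 0) (\<lambda>m v. arr V (a + m) *\<^sub>v v) (j - a)" for j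
  have xa: "x a = unit_vec (vdim V a) 0" by (simp add: x_def)
  have xS: "x (j + 1) = arr V j *\<^sub>v x j" if "a \<le> j" for j
    using that by (simp add: x_def Suc_diff_le)
  have xc: "x j \<in> carrier_vec (vdim V j)" if "a \<le> j" "j \<le> n" for j
    using that
  proof (induction j rule: dec_induct)
    case base
    then show ?case by (simp add: xa)
  next
    case (step m)
    then show ?case using xS[of m] A[of m] a(1) mult_mat_vec_carrier[of "arr V m"] by simp
  qed
  have xa0: "x a \<noteq> 0\<^sub>v (vdim V a)"
  proof
    assume "x a = 0\<^sub>v (vdim V a)"
    then have "unit_vec (vdim V a) 0 $ 0 = (0\<^sub>v (vdim V a) :: 'k vec) $ 0" unfolding xa by simp
    then show False using a(3) by simp
  qed
  let ?J = "{j \<in> {a..n}. x j \<noteq> 0\<^sub>v (vdim V j)}"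
  define b where "b = Max ?J"
  have J: "finite ?J" "a \<in> ?J" using a xa0 by auto
  have "b \<in> ?J" unfolding b_def using J by (intro Max_in) auto
  then have ab: "a \<le> b" and bn: "b \<le> n" and xb: "x b \<noteq> 0\<^sub>v (vdim V b)" by auto
  have xb1: "x (b + 1) = 0\<^sub>v (vdim V (b + 1))" if "b < n"
  proof (rule ccontr)
    assume "x (b + 1) \<noteq> 0\<^sub>v (vdim V (b + 1))"
    then have "b + 1 \<in> ?J" using that ab by auto
    then have "b + 1 \<le> b" unfolding b_def using Max_ge[OF J(1)] by blast
    then show False by simp
  qed
  obtain k where k: "k < vdim V b" "x b $ k \<noteq> 0"
    using nonzero_vec_entry[OF xc[OF ab bn] xb] by blast
  \<comment> \<open>\<open>P j\<close> is the composite of the arrows from \<open>j\<close> to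
    \<open>b\<close>, built downwards from \<open>b\<close>; its row \<open>k\<close> reads off a
    coordinate in which \<open>x b\<close> is nonzero.\<close>
  define P :: "nat \<Rightarrow> 'k mat" where
    "P j = rec_nat (1\<^sub>m (vdim V b)) (\<lambda>m B. B * arr V (b - Suc m)) (b - j)" for j
  have Pb: "P b = 1\<^sub>m (vdim V b)" by (simp add: P_def)
  have PS: "P j = P (j + 1) * arr V j" if "j < b" for j
  proof -
    have *: "b - j = Suc (b - (j + 1))" using that by simp
    show ?thesis unfolding P_def * using that by simp
  qed
  have Pc: "P j \<in> carrier_mat (vdim V b) (vdim V j)" if "j \<le> b" "a \<le> j" for j
    using that
  proof (induction j rule: inc_induct)
    case base
    then show ?case by (simp add: Pb)
  next
    case (step m)
    then show ?case using PS[of m] A[of m] a(1) bn mult_carrier_mat by force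
  qed
  have Px: "P j *\<^sub>v x j = x b" if "j \<le> b" "a \<le> j" for j
    using that
  proof (induction j rule: inc_induct)
    case base
    then show ?case using xc[of b] bn by (simp add: Pb)
  next
    case (step m)
    have "P m *\<^sub>v x m = P (m + 1) *\<^sub>v (arr V m *\<^sub>v x m)"
      unfolding PS[OF step(2)]
      using step a(1) bn
      by (intro assoc_mult_mat_vec[OF Pc[of "m + 1"] A[of m] xc[of m]]) auto
    also have "\<dots> = x b" using step xS[of m] by simp
    finally show ?case .
  qed
  have xnz: "x j \<noteq> 0\<^sub>v (vdim V j)" if "a \<le> j" "j \<le> b" for j
  proof
    assume "x j = 0\<^sub>v (vdim V j)"
    then have "x b = 0\<^sub>v (vdim V b)" using Px[of j] mat_mult_zero_vec[OF Pc[of j]] that by simp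
    then show False using xb by simp
  qed
  define U where "U j = (if a \<le> j \<and> j \<le> b then range (\<lambda>c. c \<cdot>\<^sub>v x j) else {0\<^sub>v (vdim V j)})" for j
  define W where "W j = (if a \<le> j \<and> j \<le> b
    then {v \<in> carrier_vec (vdim V j). (P j *\<^sub>v v) $ k = 0} else carrier_vec (vdim V j))" for j
  have subU: "subrep n V U"
    unfolding subrep_def
  proof (intro conjI ballI)
    fix j assume "j \<in> {1..n}"
    show "subspace class_ring (U j) (module_vec TYPE('k) (vdim V j))"
    proof (cases "a \<le> j \<and> j \<le> b")
      case True
      then have c: "x j \<in> carrier_vec (vdim V j)" using xc bn by simp
      have U: "U j = range (\<lambda>c. c \<cdot>\<^sub>v x j)" using True by (simp add: U_def)
      show ?thesis
      proof (rule subspaceI)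
        have "0\<^sub>v (vdim V j) = 0 \<cdot>\<^sub>v x j" using c by (intro eq_vecI) auto
        then show "0\<^sub>v (vdim V j) \<in> U j" unfolding U by (rule range_eqI)
        show "v + w \<in> U j" if "v \<in> U j" "w \<in> U j" for v w
          using that c unfolding U by (auto simp: add_smult_distrib_vec[symmetric])
        show "d \<cdot>\<^sub>v v \<in> U j" if "v \<in> U j" for d v
          using that c unfolding U by (auto simp: smult_smult_assoc)
      qed (use c U in auto)
    next
      case False
      then show ?thesis by (intro subspaceI) (auto simp: U_def)
    qed
  next
    fix j u assume j: "j \<in> {1..<n}" and u: "u \<in> U j"
    have Aj: "arr V j \<in> carrier_mat (vdim V (j + 1)) (vdim V j)" using A j by simp
    show "arr V j *\<^sub>v u \<in> U (j + 1)"
    proof (cases "a \<le> j \<and> j \<le> b")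
      case True
      then obtain c where c: "u = c \<cdot>\<^sub>v x j" using u by (auto simp: U_def)
      have xj: "x j \<in> carrier_vec (vdim V j)" using True xc bn by simp
      have eq: "arr V j *\<^sub>v u = c \<cdot>\<^sub>v x (j + 1)"
        unfolding c using mult_mat_vec[OF Aj xj] xS[of j] True by simp
      show ?thesis
      proof (cases "j = b")
        case True
        then have "arr V j *\<^sub>v u = 0\<^sub>v (vdim V (j + 1))" using eq xb1 j by auto
        then show ?thesis using True by (simp add: U_def)
      next
        case False
        then show ?thesis using eq \<open>a \<le> j \<and> j \<le> b\<close> by (auto simp: U_def)
      qed
    next
      case False
      then have "u = 0\<^sub>v (vdim V j)" using u by (auto simp: U_def split: if_splits)
      then have eq: "arr V j *\<^sub>v u = 0\<^sub>v (vdim V (j + 1))" using mat_mult_zero_vec[OF Aj] by simp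
      show ?thesis
      proof (cases "a \<le> j + 1 \<and> j + 1 \<le> b")
        case True
        then have "0\<^sub>v (vdim V (j + 1)) = 0 \<cdot>\<^sub>v x (j + 1)"
          using xc[of "j + 1"] bn by (intro eq_vecI) auto
        then show ?thesis unfolding eq using True by (auto simp: U_def)
      next
        case False
        then show ?thesis unfolding eq by (auto simp: U_def)
      qed
    qed
  qed
  have subW: "subrep n V W"
    unfolding subrep_def
  proof (intro conjI ballI)
    fix j assume "j \<in> {1..n}"
    show "subspace class_ring (W j) (module_vec TYPE('k) (vdim V j))"
    proof (cases "a \<le> j \<and> j \<le> b")
      case True
      then have P: "P j \<in> carrier_mat (vdim V b) (vdim V j)" using Pc by simp
      have W: "W j = {v \<in> carrier_vec (vdim V j). (P j *\<^sub>v v) $ k = 0}" using True by (simp add: W_def)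
      show ?thesis
      proof (rule subspaceI)
        show "0\<^sub>v (vdim V j) \<in> W j" unfolding W using mat_mult_zero_vec[OF P] k by simp
        show "v + w \<in> W j" if "v \<in> W j" "w \<in> W j" for v w
        proof -
          have c: "v \<in> carrier_vec (vdim V j)" "w \<in> carrier_vec (vdim V j)" using that W by auto
          have "(P j *\<^sub>v (v + w)) $ k = (P j *\<^sub>v v) $ k + (P j *\<^sub>v w) $ k"
            unfolding mult_add_distrib_mat_vec[OF P c] using P k by simp
          then show ?thesis using that W by simp
        qed
        show "d \<cdot>\<^sub>v v \<in> W j" if "v \<in> W j" for d v
        proof -
          have c: "v \<in> carrier_vec (vdim V j)" using that W by auto
          have "(P j *\<^sub>v (d \<cdot>\<^sub>v v)) $ k = d * (P j *\<^sub>v v) $ k"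
            unfolding mult_mat_vec[OF P c] using P k by simp
          then show ?thesis using that W by simp
        qed
      qed (use W in auto)
    next
      case False
      then show ?thesis by (intro subspaceI) (auto simp: W_def)
    qed
  next
    fix j u assume j: "j \<in> {1..<n}" and u: "u \<in> W j"
    have Aj: "arr V j \<in> carrier_mat (vdim V (j + 1)) (vdim V j)" using A j by simp
    have uc: "u \<in> carrier_vec (vdim V j)" using u by (auto simp: W_def split: if_splits)
    have Au: "arr V j *\<^sub>v u \<in> carrier_vec (vdim V (j + 1))" using Aj uc by simp
    consider "a \<le> j" "j < b" | "j + 1 = a" | "\<not> (a \<le> j + 1 \<and> j + 1 \<le> b)" by linarith
    then show "arr V j *\<^sub>v u \<in> W (j + 1)"
    proof cases
      case 1
      have "P j *\<^sub>v u = P (j + 1) *\<^sub>v (arr V j *\<^sub>v u)"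
        unfolding PS[OF 1(2)] using 1 by (intro assoc_mult_mat_vec[OF Pc[of "j + 1"] Aj uc]) auto
      then show ?thesis using u 1 Au by (simp add: W_def)
    next
      case 2
      then have "u = 0\<^sub>v (vdim V j)" using below[of j] j uc by (intro eq_vecI) auto
      then have "arr V j *\<^sub>v u = 0\<^sub>v (vdim V (j + 1))" using mat_mult_zero_vec[OF Aj] by simp
      then show ?thesis using 2 ab mat_mult_zero_vec[OF Pc[of a]] k Au by (simp add: W_def)
    next
      case 3
      then have "W (j + 1) = carrier_vec (vdim V (j + 1))" unfolding W_def by (rule if_not_P)
      then show ?thesis using Au by simp
    qed
  qed
  have sum: "is_direct_sum n V U W"
    unfolding is_direct_sum_def
  proof (intro ballI)
    fix j assume j: "j \<in> {1..n}"
    show "{u + w |u w. u \<in> U j \<and> w \<in> W j} = carrier_vec (vdim V j) \<and> U j \<inter> W j = {0\<^sub>v (vdim V j)}"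
    proof (cases "a \<le> j \<and> j \<le> b")
      case True
      have P: "P j \<in> carrier_mat (vdim V b) (vdim V j)" using Pc True by simp
      have xj: "x j \<in> carrier_vec (vdim V j)" using True xc bn by simp
      have U: "U j = range (\<lambda>c. c \<cdot>\<^sub>v x j)" using True by (simp add: U_def)
      have W: "W j = {v \<in> carrier_vec (vdim V j). (P j *\<^sub>v v) $ k = 0}" using True by (simp add: W_def)
      have Pcx: "(P j *\<^sub>v (c \<cdot>\<^sub>v x j)) $ k = c * x b $ k" for c
        unfolding mult_mat_vec[OF P xj] using Px[of j] True k xc[OF ab bn] by simp
      have "v \<in> {u + w |u w. u \<in> U j \<and> w \<in> W j}" if v: "v \<in> carrier_vec (vdim V j)" for v
      proof -
        let ?c = "(P j *\<^sub>v v) $ k / x b $ k"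
        have cx: "?c \<cdot>\<^sub>v x j \<in> carrier_vec (vdim V j)" using xj by simp
        have "(P j *\<^sub>v (v - ?c \<cdot>\<^sub>v x j)) $ k = (P j *\<^sub>v v) $ k - (P j *\<^sub>v (?c \<cdot>\<^sub>v x j)) $ k"
          unfolding mult_minus_distrib_mat_vec[OF P v cx] using P k by simp
        also have "\<dots> = 0" unfolding Pcx using k by simp
        finally have "v - ?c \<cdot>\<^sub>v x j \<in> W j" unfolding W using v cx by simp
        moreover have "?c \<cdot>\<^sub>v x j \<in> U j" unfolding U by blast
        moreover have "v = ?c \<cdot>\<^sub>v x j + (v - ?c \<cdot>\<^sub>v x j)" using v xj by (intro eq_vecI) auto
        ultimately show ?thesis by blast
      qed
      moreover have "u + w \<in> carrier_vec (vdim V j)" if "u \<in> U j" "w \<in> W j" for u w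
        using that xj unfolding U W by auto
      moreover have "v = 0\<^sub>v (vdim V j)" if vU: "v \<in> U j" and vW: "v \<in> W j" for v
      proof -
        obtain c where c: "v = c \<cdot>\<^sub>v x j" using vU unfolding U by blast
        have "c * x b $ k = 0" using vW Pcx[of c] unfolding W c by simp
        then have "c = 0" using k by simp
        then show ?thesis unfolding c using xj by (intro eq_vecI) auto
      qed
      moreover have "0\<^sub>v (vdim V j) \<in> U j" "0\<^sub>v (vdim V j) \<in> W j"
        using subU subW j subspaceD(2) unfolding subrep_def by blast+
      ultimately show ?thesis by blast
    next
      case False
      then have U: "U j = {0\<^sub>v (vdim V j)}" and W: "W j = carrier_vec (vdim V j)"
        unfolding U_def W_def by (simp_all only: if_False)
      have "\<exists>u w. v = u + w \<and> u \<in> U j \<and> w \<in> W j" if "v \<in> carrier_vec (vdim V j)" for v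
        using that by (intro exI[of _ "0\<^sub>v (vdim V j)"] exI[of _ v]) (simp add: U W)
      then show ?thesis unfolding U W by auto
    qed
  qed
  have "x a \<in> U a" unfolding U_def using ab by (auto intro!: image_eqI[of _ _ 1])
  then have "nonzero_subrep n V U"
    unfolding nonzero_subrep_def using subU a xa0 by (intro conjI bexI[of _ a]) auto
  then have "\<not> nonzero_subrep n V W" using ind sum unfolding indecomposable_def by blast
  then have W0: "W j = {0\<^sub>v (vdim V j)}" if "j \<in> {1..n}" for j
    using subW that unfolding nonzero_subrep_def by blast
  have dims: "vdim V j = (if a \<le> j \<and> j \<le> b then 1 else 0)" if j: "j \<in> {1..n}" for j
  proof (cases "a \<le> j \<and> j \<le> b")
    case True
    have "{u + w |u w. u \<in> U j \<and> w \<in> W j} = carrier_vec (vdim V j)"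
      using sum j unfolding is_direct_sum_def by blast
    moreover have "u + 0\<^sub>v (vdim V j) = u" if "u \<in> U j" for u
      using that True xc bn by (auto simp: U_def)
    ultimately have "carrier_vec (vdim V j) \<subseteq> U j" unfolding W0[OF j] by force
    then have "carrier_vec (vdim V j) \<subseteq> range (\<lambda>c. c \<cdot>\<^sub>v x j)" using True by (simp add: U_def)
    then have "vdim V j = 1"
      using dim_eq_1_if_carrier_multiples[OF xc xnz] True bn by simp
    then show ?thesis using True by simp
  next
    case False
    then have "carrier_vec (vdim V j) = {0\<^sub>v (vdim V j) :: 'k vec}"
      using W0[OF j] unfolding W_def by (simp only: if_False)
    then have "vdim V j = 0" by (rule carrier_vec_zero_iff[THEN iffD1])
    then show ?thesis using False by (simp only: if_False)
  qed
  have "arr V j $$ (0, 0) \<noteq> 0" if j: "j \<in> {a..<b}" for j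
  proof
    assume z: "arr V j $$ (0, 0) = 0"
    have d: "vdim V j = 1" "vdim V (j + 1) = 1" using dims[of j] dims[of "j + 1"] j a bn by auto
    have Aj: "arr V j \<in> carrier_mat 1 1" using A[of j] j a bn d by simp
    have xj: "x j \<in> carrier_vec 1" using xc[of j] j bn d by simp
    have "arr V j *\<^sub>v x j = 0\<^sub>v 1"
      using Aj xj z by (intro eq_vecI) (auto simp: scalar_prod_def)
    then show False using xnz[of "j + 1"] xS[of j] j d by simp
  qed
  then have "interval_module n V a b"
    unfolding interval_module_def using rep a ab bn dims by blast
  then show ?thesis using that by blast
qed


section \<open>Sequences of compatible intervals\<close>

text \<open>Here \<open>[c, d]\<close> is the support of the earlier module of the pair: the first conjunct
  is the vanishing of \<open>Hom\<close> from the later to the earlier module, the second one that of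
  \<open>Ext\<^sup>1\<close>.\<close>

definition compat :: "nat \<Rightarrow> nat \<Rightarrow> nat \<Rightarrow> nat \<Rightarrow> bool" where
  "compat c d a b \<longleftrightarrow> \<not> (c \<le> a \<and> a \<le> d \<and> d \<le> b) \<and> \<not> (a < c \<and> c \<le> b + 1 \<and> b + 1 \<le> d)"

text \<open>In this form partial overlap has disappeared, which gives laminarity; the strict
  inequalities that remain encode which of two intervals with common or adjacent end points comes
  first.\<close>

lemma compat_iff:
  assumes "c \<le> d" "a \<le> b"
  shows "compat c d a b \<longleftrightarrow>
    d < a \<or> b + 1 < c \<or> (c \<le> a \<and> b < d) \<or> (a < c \<and> d \<le> b)"
  using assms unfolding compat_def by auto

text \<open>Comparing sets rather than labels over an arbitrary index set lets the same notion serve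
  the forest and the tree with its master root.\<close>

definition tree :: "nat set \<Rightarrow> (nat \<Rightarrow> nat set) \<Rightarrow> (nat \<times> nat) set" where
  "tree K S = {(u, v). u \<in> K \<and> v \<in> K \<and> S u \<subset> S v \<and> \<not> (\<exists>w\<in>K. S u \<subset> S w \<and> S w \<subset> S v)}"

lemma interval_disjoint:
  fixes a b c d :: nat
  assumes "a \<le> b" "c \<le> d"
  shows "{a..b} \<inter> {c..d} = {} \<longleftrightarrow> b < c \<or> d < a"
  using assms by (auto simp: disjoint_iff not_less)

lemma ex_max_card:
  fixes f :: "nat \<Rightarrow> nat"
  assumes "finite A" "A \<noteq> {}"
  shows "\<exists>j\<in>A. \<forall>j'\<in>A. f j' \<le> f j"
proof -
  have "Max (f ` A) \<in> f ` A" using assms by simp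
  then obtain j where "j \<in> A" "f j = Max (f ` A)" by force
  then have "\<forall>j'\<in>A. f j' \<le> f j" using assms by simp
  then show ?thesis using \<open>j \<in> A\<close> by blast
qed

definition ivals :: "(nat \<Rightarrow> nat) \<Rightarrow> (nat \<Rightarrow> nat) \<Rightarrow> nat \<Rightarrow> nat set" where
  "ivals l r k = {l k..r k}"

text \<open>\<open>K\<close> need not be an initial segment and \<open>N\<close> only bounds end
  points: the locale is used with the positions \<open>{1..n}\<close>, with the master root at 0
  added, and with doubled positions that make room for one more interval.\<close>

locale interval_seq =
  fixes K :: "nat set" and N :: nat and l r :: "nat \<Rightarrow> nat"
  assumes fin: "finite K"
    and bounds: "k \<in> K \<Longrightarrow> 1 \<le> l k \<and> l k \<le> r k \<and> r k \<le> N"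
    and comp: "\<lbrakk>i \<in> K; j \<in> K; i < j\<rbrakk> \<Longrightarrow> compat (l i) (r i) (l j) (r j)"
begin

abbreviation S :: "nat \<Rightarrow> nat set" where "S \<equiv> ivals l r"

lemma S_nonempty: "k \<in> K \<Longrightarrow> S k \<noteq> {}"
  using bounds by (force simp: ivals_def)

lemma finite_S: "finite (S k)"
  by (simp add: ivals_def)

lemma laminar:
  assumes "u \<in> K" "v \<in> K" "u \<noteq> v"
  shows "S u \<subset> S v \<or> S v \<subset> S u \<or> S u \<inter> S v = {}"
proof -
  have *: "S u \<subset> S v \<or> S v \<subset> S u \<or> S u \<inter> S v = {}" if "u \<in> K" "v \<in> K" "u < v" for u v
    using comp[OF that] bounds[OF that(1)] bounds[OF that(2)]
    by (auto simp: ivals_def atLeastatMost_psubset_iff compat_iff)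
  show ?thesis
    using assms *[of u v] *[of v u] by (cases u v rule: linorder_cases) auto
qed

lemma order_adjacent:
  assumes "i \<in> K" "j \<in> K" "r i + 1 = l j" shows "i < j"
  using comp[of j i] bounds[OF assms(1)] bounds[OF assms(2)] assms
  by (cases i j rule: linorder_cases) (auto simp: compat_def)

lemma order_same_left:
  assumes "i \<in> K" "j \<in> K" "S j \<subset> S i" "l i = l j" shows "i < j"
  using comp[of j i] bounds[OF assms(1)] bounds[OF assms(2)] assms
  by (cases i j rule: linorder_cases) (auto simp: compat_def ivals_def atLeastatMost_psubset_iff)

lemma order_same_right:
  assumes "i \<in> K" "j \<in> K" "S j \<subset> S i" "r i = r j" shows "j < i"
  using comp[of i j] bounds[OF assms(1)] bounds[OF assms(2)] assms
  by (cases i j rule: linorder_cases) (auto simp: compat_def ivals_def atLeastatMost_psubset_iff)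

section \<open>Covered points and chains of children\<close>

definition covered :: "nat \<Rightarrow> nat \<Rightarrow> bool" where
  "covered k q \<longleftrightarrow> (\<exists>j\<in>K. S j \<subset> S k \<and> q \<in> S j)"

lemma covered_child:
  assumes "k \<in> K" "covered k q"
  obtains j where "(j, k) \<in> tree K S" "q \<in> S j"
proof -
  let ?A = "{j \<in> K. S j \<subset> S k \<and> q \<in> S j}"
  have "finite ?A" "?A \<noteq> {}" using fin assms by (auto simp: covered_def)
  then obtain j where j: "j \<in> ?A" and max: "\<And>j'. j' \<in> ?A \<Longrightarrow> card (S j') \<le> card (S j)"
    using ex_max_card[of ?A "\<lambda>j. card (S j)"] by blast
  have "(j, k) \<in> tree K S"
  proof -
    have False if w: "w \<in> K" "S j \<subset> S w" "S w \<subset> S k" for w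
    proof -
      have "w \<in> ?A" using w j by blast
      then show False using max[of w] psubset_card_mono[OF finite_S w(2)] by simp
    qed
    then show ?thesis using j assms(1) by (auto simp: tree_def)
  qed
  then show ?thesis using that j by auto
qed

lemma siblings_disjoint:
  assumes "(i, k) \<in> tree K S" "(j, k) \<in> tree K S" "i \<noteq> j"
  shows "S i \<inter> S j = {}"
  using assms laminar[of i j] by (auto simp: tree_def)

text \<open>The child covering the point after \<open>r j\<close> is disjoint from \<open>j\<close>,
  so it begins exactly there and comes later; the walk repeats from this child. The second conjunct
  remembers an intermediate member, which consecutive positions cannot have.\<close>

lemma chain_between:
  assumes "(j, k) \<in> tree K S" "(j', k) \<in> tree K S" "r j < l j'"
    and "\<And>q. r j < q \<Longrightarrow> q < l j' \<Longrightarrow> covered k q"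
  shows "j < j' \<and> (r j + 1 < l j' \<longrightarrow> (\<exists>m\<in>K. j < m \<and> m < j'))"
  using assms
proof (induction "l j' - r j" arbitrary: j rule: less_induct)
  case less
  have K: "j \<in> K" "j' \<in> K" "k \<in> K" using less.prems by (auto simp: tree_def)
  show ?case
  proof (cases "r j + 1 = l j'")
    case True
    then show ?thesis using order_adjacent K by auto
  next
    case False
    then have "covered k (r j + 1)" using less.prems by auto
    then obtain m where m: "(m, k) \<in> tree K S" "r j + 1 \<in> S m"
      using covered_child K by blast
    have mK: "m \<in> K" using m by (auto simp: tree_def)
    have "j \<noteq> m" using m(2) by (auto simp: ivals_def)
    have "m \<noteq> j'" using m(2) False less.prems(3) by (auto simp: ivals_def)
    have "S j \<inter> S m = {}" "S m \<inter> S j' = {}"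
      using siblings_disjoint less.prems m \<open>j \<noteq> m\<close> \<open>m \<noteq> j'\<close> by auto
    then have sep: "r j < l m \<or> r m < l j" "r m < l j' \<or> r j' < l m"
      using bounds[OF K(1)] bounds[OF K(2)] bounds[OF mK] by (auto simp: ivals_def interval_disjoint)
    then have "l m = r j + 1" "r m < l j'"
      using m(2) less.prems(3) bounds[OF K(1)] bounds[OF K(2)] bounds[OF mK] sep
      unfolding ivals_def by auto
    then have "j < m" using order_adjacent K mK by auto
    moreover have "m < j'"
      using less.hyps[of m] less.prems m \<open>l m = r j + 1\<close> \<open>r m < l j'\<close> bounds[OF mK] by auto
    ultimately show ?thesis using mK by auto
  qed
qed

text \<open>The chain starts with the child containing \<open>l k\<close>: it shares the left end
  point with \<open>k\<close> and is smaller, so it comes after \<open>k\<close>.\<close>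

lemma chain_from_left:
  assumes j: "(j, k) \<in> tree K S"
    and cov: "\<And>q. l k \<le> q \<Longrightarrow> q < l j \<Longrightarrow> covered k q"
  shows "k < j \<and> (l k < l j \<longrightarrow> (\<exists>m\<in>K. k < m \<and> m < j))"
proof (cases "l k = l j")
  case True
  then show ?thesis using order_same_left j by (auto simp: tree_def)
next
  case False
  have K: "j \<in> K" "k \<in> K" "S j \<subset> S k" using j by (auto simp: tree_def)
  then have "l k < l j" using False bounds by (auto simp: ivals_def atLeastatMost_psubset_iff)
  then obtain m where m: "(m, k) \<in> tree K S" "l k \<in> S m"
    using covered_child K cov by (metis le_refl)
  have mK: "m \<in> K" "S m \<subset> S k" using m by (auto simp: tree_def)
  then have lm: "l m = l k" using m(2) by (auto simp: ivals_def)
  then have "k < m" using order_same_left mK K by auto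
  have "m \<noteq> j" using lm False by auto
  then have "S m \<inter> S j = {}" using siblings_disjoint j m by auto
  then have "r m < l j" using lm \<open>l k < l j\<close> bounds[OF K(1)] bounds[OF mK(1)]
    by (auto simp: ivals_def interval_disjoint)
  then have "m < j" using chain_between[OF m(1) j] cov lm bounds[OF mK(1)] by auto
  then show ?thesis using \<open>k < m\<close> mK by auto
qed

text \<open>Mirror image: the chain ends with the child containing \<open>r k\<close>, which shares
  the right end point with \<open>k\<close> and so comes before \<open>k\<close>.\<close>

lemma chain_to_right:
  assumes j: "(j, k) \<in> tree K S"
    and cov: "\<And>q. r j < q \<Longrightarrow> q \<le> r k \<Longrightarrow> covered k q"
  shows "j < k \<and> (r j < r k \<longrightarrow> (\<exists>m\<in>K. j < m \<and> m < k))"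
proof (cases "r k = r j")
  case True
  then show ?thesis using order_same_right j by (auto simp: tree_def)
next
  case False
  have K: "j \<in> K" "k \<in> K" "S j \<subset> S k" using j by (auto simp: tree_def)
  then have "r j < r k" using False bounds by (auto simp: ivals_def atLeastatMost_psubset_iff)
  then obtain m where m: "(m, k) \<in> tree K S" "r k \<in> S m"
    using covered_child K cov by (metis le_refl)
  have mK: "m \<in> K" "S m \<subset> S k" using m by (auto simp: tree_def)
  then have rm: "r m = r k" using m(2) by (auto simp: ivals_def)
  then have "m < k" using order_same_right mK K by auto
  have "m \<noteq> j" using rm False by auto
  then have "S j \<inter> S m = {}" using siblings_disjoint j m by auto
  then have "r j < l m" using rm \<open>r j < r k\<close> bounds[OF K(1)] bounds[OF mK(1)]
    by (auto simp: ivals_def interval_disjoint)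
  then have "j < m" using chain_between[OF j m(1)] cov rm bounds[OF mK(1)] by auto
  then show ?thesis using \<open>m < k\<close> mK by auto
qed

lemma ex_uncovered:
  assumes "k \<in> K" obtains p where "p \<in> S k" "\<not> covered k p"
proof -
  have False if cov: "\<And>q. q \<in> S k \<Longrightarrow> covered k q"
  proof -
    have "covered k (l k)" using cov bounds[OF assms] by (auto simp: ivals_def)
    then obtain j where j: "(j, k) \<in> tree K S" "l k \<in> S j"
      using covered_child assms by blast
    then have K: "j \<in> K" "S j \<subset> S k" by (auto simp: tree_def)
    then have "l j = l k" using j by (auto simp: ivals_def)
    then have "k < j" using order_same_left K assms by auto
    moreover have "j < k" using chain_to_right[OF j(1)] cov bounds[OF K(1)] \<open>l j = l k\<close>
      by (auto simp: ivals_def)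
    ultimately show False by simp
  qed
  then show ?thesis using that by blast
qed

section \<open>Counting by gaps\<close>

definition gap :: "nat \<Rightarrow> nat" where
  "gap k = (SOME p. p \<in> S k \<and> \<not> covered k p)"

lemma gap: "k \<in> K \<Longrightarrow> gap k \<in> S k" "k \<in> K \<Longrightarrow> \<not> covered k (gap k)"
proof -
  have "gap k \<in> S k \<and> \<not> covered k (gap k)" if "k \<in> K"
    unfolding gap_def by (rule someI_ex) (use ex_uncovered[OF that] in blast)
  then show "k \<in> K \<Longrightarrow> gap k \<in> S k" "k \<in> K \<Longrightarrow> \<not> covered k (gap k)" by auto
qed

text \<open>Two different intervals containing \<open>p\<close> are nested, and then the smaller one
  covers \<open>p\<close> in the larger one.\<close>

lemma uncovered_inj:
  assumes "k \<in> K" "k' \<in> K" "p \<in> S k" "p \<in> S k'" "\<not> covered k p" "\<not> covered k' p"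
  shows "k = k'"
proof (rule ccontr)
  assume "k \<noteq> k'"
  moreover have "S k \<inter> S k' \<noteq> {}" using assms by blast
  ultimately have "S k \<subset> S k' \<or> S k' \<subset> S k" using laminar assms by blast
  then show False using assms unfolding covered_def by blast
qed

lemma inj_gap: "inj_on gap K"
proof (rule inj_onI)
  fix x y assume "x \<in> K" "y \<in> K" "gap x = gap y"
  then show "x = y" using gap[of x] gap[of y] uncovered_inj[of x y "gap x"] by simp
qed

lemma gap_image: "gap ` K \<subseteq> {1..N}"
proof
  fix x assume "x \<in> gap ` K"
  then show "x \<in> {1..N}" using gap(1) bounds by (fastforce simp: ivals_def)
qed

lemma card_le: "card K \<le> N"
  using card_inj_on_le[OF inj_gap gap_image] by simp

end

locale complete_interval_seq = interval_seq +
  assumes card_eq: "card K = N"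
begin

text \<open>By counting, the gaps exhaust \<open>{1..N}\<close>. So \<open>p\<close> is the gap of
  some member, and by \<open>uncovered_inj\<close> this member is \<open>k\<close>.\<close>

lemma uncovered_unique:
  assumes "k \<in> K" "p \<in> S k" "\<not> covered k p" shows "p = gap k"
proof -
  have "gap ` K = {1..N}"
    using card_subset_eq[OF _ gap_image] card_image[OF inj_gap] card_eq by simp
  moreover have "p \<in> {1..N}" using assms bounds[OF assms(1)] by (auto simp: ivals_def)
  ultimately have "p \<in> gap ` K" by simp
  then obtain k' where "k' \<in> K" "p = gap k'" by blast
  then show ?thesis using uncovered_inj[of k k' p] assms gap[of k'] by simp
qed

lemma coveredI: "\<lbrakk>k \<in> K; l k \<le> p; p \<le> r k; p \<noteq> gap k\<rbrakk> \<Longrightarrow> covered k p"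
  using uncovered_unique by (auto simp: ivals_def)

text \<open>If the gap of the parent were left of the child, the chain to the right would put the
  child before the parent. So it is on the right, everything left of the child is covered, and a
  nonempty left part would need a position strictly between \<open>i\<close> and
  \<open>Suc i\<close>.\<close>

lemma consecutive_parent_child:
  assumes "Suc i \<in> K" "(Suc i, i) \<in> tree K S"
  shows "l (Suc i) = l i"
proof -
  have K: "i \<in> K" "S (Suc i) \<subset> S i" using assms by (auto simp: tree_def)
  have "gap i \<notin> S (Suc i)" using gap(2)[OF K(1)] assms K unfolding covered_def by blast
  have sub: "l i \<le> l (Suc i)" "r (Suc i) \<le> r i" using K bounds[OF assms(1)]
    by (auto simp: ivals_def)
  have b: "l (Suc i) \<le> r (Suc i)" using bounds[OF assms(1)] by simp
  have "\<not> gap i < l (Suc i)"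
  proof
    assume "gap i < l (Suc i)"
    then have "Suc i < i"
      using chain_to_right[OF assms(2)] coveredI[OF K(1)] sub b
      by auto
    then show False by simp
  qed
  then have "r (Suc i) < gap i" using \<open>gap i \<notin> S (Suc i)\<close> by (auto simp: ivals_def)
  then have "l i < l (Suc i) \<longrightarrow> (\<exists>m\<in>K. i < m \<and> m < Suc i)"
    using chain_from_left[OF assms(2)] coveredI[OF K(1)] sub b by auto
  then show ?thesis using sub by (auto simp: le_less)
qed

text \<open>As before with left and right exchanged: the reversed order of positions forces the gap
  to the left of the child.\<close>

lemma consecutive_child_parent:
  assumes "Suc i \<in> K" "(i, Suc i) \<in> tree K S"
  shows "r i = r (Suc i)"
proof -
  have K: "i \<in> K" "S i \<subset> S (Suc i)" using assms by (auto simp: tree_def)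
  have "gap (Suc i) \<notin> S i" using gap(2)[OF assms(1)] assms K unfolding covered_def by blast
  have sub: "l (Suc i) \<le> l i" "r i \<le> r (Suc i)" using K bounds[OF K(1)]
    by (auto simp: ivals_def)
  have b: "l i \<le> r i" using bounds[OF K(1)] by simp
  have "\<not> r i < gap (Suc i)"
  proof
    assume "r i < gap (Suc i)"
    then have "Suc i < i"
      using chain_from_left[OF assms(2)] coveredI[OF assms(1)] sub b by auto
    then show False by simp
  qed
  then have "gap (Suc i) < l i" using \<open>gap (Suc i) \<notin> S i\<close> by (auto simp: ivals_def)
  then have "r i < r (Suc i) \<longrightarrow> (\<exists>m\<in>K. i < m \<and> m < Suc i)"
    using chain_to_right[OF assms(2)] coveredI[OF assms(1)] sub b by auto
  then show ?thesis using sub by (auto simp: le_less)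
qed

text \<open>The gap of the parent cannot lie between the two: the chains outwards would order one
  sibling before \<open>k\<close> and the other after it in a way that consecutive positions do not
  allow. So the hole is covered, and \<open>chain_between\<close> fixes the order and leaves no room
  for it.\<close>

lemma consecutive_siblings:
  assumes "(i, k) \<in> tree K S" "(Suc i, k) \<in> tree K S"
  shows "r i + 1 = l (Suc i)"
proof -
  have K: "i \<in> K" "Suc i \<in> K" "k \<in> K" "S i \<subset> S k" "S (Suc i) \<subset> S k"
    using assms by (auto simp: tree_def)
  have disj: "S i \<inter> S (Suc i) = {}" using siblings_disjoint[OF assms] by simp
  have sub: "l k \<le> l i" "r i \<le> r k" "l k \<le> l (Suc i)" "r (Suc i) \<le> r k"
    "l i \<le> r i" "l (Suc i) \<le> r (Suc i)"
    using K bounds[OF K(1)] bounds[OF K(2)] by (auto simp: ivals_def)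
  consider "r i < l (Suc i)" | "r (Suc i) < l i"
    using disj sub by (auto simp: ivals_def interval_disjoint)
  then show ?thesis
  proof cases
    case 1
    have "\<not> (r i < gap k \<and> gap k < l (Suc i))"
    proof
      assume "r i < gap k \<and> gap k < l (Suc i)"
      then have "k < i" "Suc i < k"
        using chain_from_left[OF assms(1)] chain_to_right[OF assms(2)] coveredI[OF K(3)] sub
        by auto
      then show False by simp
    qed
    then have "covered k q" if "r i < q" "q < l (Suc i)" for q
      using coveredI[OF K(3)] that sub by auto
    then show ?thesis using chain_between[OF assms 1] 1 by auto
  next
    case 2
    have "\<not> (r (Suc i) < gap k \<and> gap k < l i)"
    proof
      assume "r (Suc i) < gap k \<and> gap k < l i"
      then have "k < Suc i" "i < k"
        using chain_from_left[OF assms(2)] chain_to_right[OF assms(1)] coveredI[OF K(3)] sub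
        by auto
      then show False by simp
    qed
    then have "covered k q" if "r (Suc i) < q" "q < l i" for q
      using coveredI[OF K(3)] that sub by auto
    then show ?thesis using chain_between[OF assms(2,1) 2] by auto
  qed
qed

end


section \<open>Trees of laminar families\<close>

text \<open>The alternatives are strict and the sets nonempty, so distinct indices carry distinct
  sets. From here on the tree arguments are free of end points.\<close>

definition laminar_on :: "nat set \<Rightarrow> (nat \<Rightarrow> nat set) \<Rightarrow> bool" where
  "laminar_on K S \<longleftrightarrow> finite K \<and> (\<forall>u\<in>K. S u \<noteq> {} \<and> finite (S u)) \<and>
     (\<forall>u\<in>K. \<forall>v\<in>K. u \<noteq> v \<longrightarrow> S u \<subset> S v \<or> S v \<subset> S u \<or> S u \<inter> S v = {})"

lemma treeI:
  assumes "u \<in> K" "v \<in> K" "S u \<subset> S v"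
    and "\<And>w. \<lbrakk>w \<in> K; S u \<subset> S w; S w \<subset> S v\<rbrakk> \<Longrightarrow> False"
  shows "(u, v) \<in> tree K S"
  using assms by (auto simp: tree_def)

lemma treeD:
  assumes "(u, v) \<in> tree K S"
  shows "u \<in> K" "v \<in> K" "S u \<subset> S v" "u \<noteq> v"
    and "\<lbrakk>w \<in> K; S u \<subset> S w; S w \<subset> S v\<rbrakk> \<Longrightarrow> False"
  using assms by (auto simp: tree_def)

lemma laminar_onD:
  assumes "laminar_on K S" "u \<in> K" "v \<in> K" "S u \<inter> S v \<noteq> {}" "u \<noteq> v"
  shows "S u \<subset> S v \<or> S v \<subset> S u"
  using assms unfolding laminar_on_def by blast

lemma tree_disjoint:
  assumes "laminar_on K S" "(u, k) \<in> tree K S" "(v, k) \<in> tree K S" "u \<noteq> v"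
  shows "S u \<inter> S v = {}"
proof (rule ccontr)
  assume "S u \<inter> S v \<noteq> {}"
  then have "S u \<subset> S v \<or> S v \<subset> S u"
    by (rule laminar_onD[OF assms(1) treeD(1)[OF assms(2)] treeD(1)[OF assms(3)] _ assms(4)])
  then show False
    using treeD(5)[OF assms(2) treeD(1)[OF assms(3)]] treeD(5)[OF assms(3) treeD(1)[OF assms(2)]]
      treeD(3)[OF assms(2)] treeD(3)[OF assms(3)] by simp blast
qed

lemma tree_parent_least:
  assumes "laminar_on K S" "(u, k) \<in> tree K S" "w \<in> K" "S u \<subset> S w"
  shows "S k \<subseteq> S w"
proof (rule ccontr)
  assume *: "\<not> S k \<subseteq> S w"
  have "S u \<noteq> {}" using assms treeD(1)[OF assms(2)] by (simp add: laminar_on_def)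
  then have "S k \<inter> S w \<noteq> {}" using assms(4) treeD(3)[OF assms(2)] by blast
  moreover have "k \<noteq> w" using * by blast
  ultimately have "S w \<subset> S k" using laminar_onD[OF assms(1)] treeD[OF assms(2)] assms(3) *
    by blast
  then show False using treeD(5)[OF assms(2,3,4)] by simp
qed

lemma single_valued_tree:
  assumes "laminar_on K S" shows "single_valued (tree K S)"
proof (rule single_valuedI)
  fix u v w assume *: "(u, v) \<in> tree K S" "(u, w) \<in> tree K S"
  have "S v = S w"
    using tree_parent_least[OF assms *(1) treeD(2,3)[OF *(2)]]
      tree_parent_least[OF assms *(2) treeD(2,3)[OF *(1)]] by simp
  moreover have "S v \<noteq> {}" using treeD(3)[OF *(1)] by blast
  ultimately show "v = w"
    using laminar_onD[OF assms treeD(2)[OF *(1)] treeD(2)[OF *(2)]] by auto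
qed

lemma tree_parent_exists:
  assumes "laminar_on K S" "u \<in> K" "v \<in> K" "S u \<subset> S v"
  obtains k where "(u, k) \<in> tree K S"
proof -
  let ?A = "{w \<in> K. S u \<subset> S w}"
  have fin: "finite (S ` ?A)" and ne: "S ` ?A \<noteq> {}"
    using assms by (auto simp: laminar_on_def)
  obtain X where X: "X \<in> S ` ?A" "\<forall>Y\<in>S ` ?A. Y \<subseteq> X \<longrightarrow> X = Y"
    by (rule bexE[OF finite_has_minimal[OF fin ne]])
  then obtain k where k: "k \<in> K" "S u \<subset> S k" "X = S k" by blast
  have "(u, k) \<in> tree K S"
  proof (rule treeI[OF assms(2) k(1,2)])
    fix w assume w: "w \<in> K" "S u \<subset> S w" "S w \<subset> S k"
    then have "X = S w" using X(2) k(3) by auto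
    then show False using w k by simp
  qed
  then show ?thesis using that by blast
qed

lemma sub_single_valued_eq:
  assumes "A \<subseteq> B" "single_valued B" "\<And>u v. (u, v) \<in> B \<Longrightarrow> \<exists>w. (u, w) \<in> A"
  shows "A = B"
proof (rule antisym[OF assms(1)], rule subrelI)
  fix u v assume uv: "(u, v) \<in> B"
  then obtain w where "(u, w) \<in> A" using assms(3) by blast
  moreover from this have "v = w"
    using assms(1) single_valuedD[OF assms(2) uv] by auto
  ultimately show "(u, v) \<in> A" by simp
qed

text \<open>\<open>S' i\<close> is left open, since it is a difference, a union or
  \<open>S j\<close> depending on the case. Laminarity of the new family is an assumption here
  because the interval side supplies it.\<close>

locale mutation =
  fixes K :: "nat set" and S S' :: "nat \<Rightarrow> nat set" and i j :: nat
  assumes lam: "laminar_on K S" and lam': "laminar_on K S'"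
    and iK: "i \<in> K" and jK: "j \<in> K" and neq: "i \<noteq> j"
    and other: "\<lbrakk>w \<noteq> i; w \<noteq> j\<rbrakk> \<Longrightarrow> S' w = S w" and S'j: "S' j = S i"
begin

lemma treeI':
  assumes "u \<in> K" "v \<in> K" "S' u \<subset> S' v"
    and "S' u \<subset> S' i \<Longrightarrow> S' i \<subset> S' v \<Longrightarrow> False"
    and "S' u \<subset> S i \<Longrightarrow> S i \<subset> S' v \<Longrightarrow> False"
    and "\<And>w. \<lbrakk>w \<in> K; w \<noteq> i; w \<noteq> j; S' u \<subset> S w; S w \<subset> S' v\<rbrakk> \<Longrightarrow> False"
  shows "(u, v) \<in> tree K S'"
proof (rule treeI)
  fix w assume *: "w \<in> K" "S' u \<subset> S' w" "S' w \<subset> S' v"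
  then consider "w = i" | "w = j" | "w \<noteq> i" "w \<noteq> j" by blast
  then show False
  proof cases
    case 1
    then show ?thesis using * assms(4) by simp
  next
    case 2
    then show ?thesis using * assms(5) S'j by simp
  next
    case 3
    then show ?thesis using * assms(6)[of w] other[of w] by simp
  qed
qed (use assms in auto)

text \<open>The old set of \<open>i\<close> survives at \<open>j\<close>, so \<open>S' i\<close> is
  the only set that could newly separate \<open>u\<close> from \<open>v\<close>.\<close>

lemma unchangedI:
  assumes "(u, v) \<in> tree K S" "u \<notin> {i, j}" "v \<notin> {i, j}"
    and "S u \<subset> S' i \<Longrightarrow> S' i \<subset> S v \<Longrightarrow> False"
  shows "(u, v) \<in> tree K S'"
proof (rule treeI')
  have [simp]: "S' u = S u" "S' v = S v" using other assms by auto
  show "u \<in> K" "v \<in> K" "S' u \<subset> S' v" using treeD[OF assms(1)] by auto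
  show "S' u \<subset> S' i \<Longrightarrow> S' i \<subset> S' v \<Longrightarrow> False" using assms by simp
  show "S' u \<subset> S i \<Longrightarrow> S i \<subset> S' v \<Longrightarrow> False" using treeD(5)[OF assms(1) iK] by simp
  show "\<And>w. \<lbrakk>w \<in> K; w \<noteq> i; w \<noteq> j; S' u \<subset> S w; S w \<subset> S' v\<rbrakk> \<Longrightarrow> False"
    using treeD(5)[OF assms(1)] by simp
qed

text \<open>The point \<open>p\<close> is the gap of the parent. It lies in
  \<open>S i - S j\<close>, so a set strictly containing \<open>S' i\<close> contains
  \<open>p\<close> and cannot be strictly inside \<open>S i\<close>; and the remaining children miss
  \<open>p\<close>, which makes them strictly smaller than \<open>S' i\<close>.\<close>

lemma parent_of_child:
  assumes ji: "(j, i) \<in> tree K S" and ik: "(i, k) \<in> tree K S"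
    and S'i: "S' i = S i - S j"
    and p: "p \<in> S i" "\<And>w. w \<in> K \<Longrightarrow> S w \<subset> S i \<Longrightarrow> p \<notin> S w"
  shows "(j, k) \<in> tree K S'" "(i, j) \<in> tree K S'"
    and "(u, j) \<in> tree K S \<Longrightarrow> (u, j) \<in> tree K S'"
    and "(u, i) \<in> tree K S \<Longrightarrow> u \<noteq> j \<Longrightarrow> (u, i) \<in> tree K S'"
    and "(u, v) \<in> tree K S \<Longrightarrow> u \<notin> {i, j} \<Longrightarrow> v \<notin> {i, j} \<Longrightarrow> (u, v) \<in> tree K S'"
proof -
  have kK: "k \<in> K" and Sik: "S i \<subset> S k" and Sji: "S j \<subset> S i"
    using treeD[OF ik] treeD[OF ji] by auto
  have knij: "k \<noteq> i" "k \<noteq> j" using Sik Sji by auto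
  have pj: "p \<notin> S j" using p(2)[OF jK Sji] .
  have ne: "S u \<noteq> {}" if "u \<in> K" for u using that lam by (simp add: laminar_on_def)
  show "(j, k) \<in> tree K S'"
  proof (rule treeI'[OF jK kK])
    fix w assume w: "w \<in> K" "w \<noteq> i" "w \<noteq> j" "S' j \<subset> S w" "S w \<subset> S' k"
    then show False using treeD(5)[OF ik w(1)] S'j other[OF knij] by simp
  qed (use Sik S'j S'i other[OF knij] in auto)
  show "(i, j) \<in> tree K S'"
  proof (rule treeI'[OF iK jK])
    fix w assume w: "w \<in> K" "w \<noteq> i" "w \<noteq> j" "S' i \<subset> S w" "S w \<subset> S' j"
    have "p \<in> S w" using w(4) p(1) pj S'i by blast
    then show False using p(2)[OF w(1)] w(5) S'j by simp
  qed (use S'i S'j Sji ne[OF jK] in auto)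
  show "(u, j) \<in> tree K S'" if u: "(u, j) \<in> tree K S"
  proof -
    have uK: "u \<in> K" "S u \<subset> S j" using treeD[OF u] by auto
    have un: "u \<noteq> i" "u \<noteq> j" using uK Sji by auto
    then have [simp]: "S' u = S u" using other by simp
    show ?thesis
    proof (rule treeI'[OF uK(1) jK])
      show "S' u \<subset> S' i \<Longrightarrow> S' i \<subset> S' j \<Longrightarrow> False" using S'i uK ne[OF uK(1)] by auto
      fix w assume w: "w \<in> K" "w \<noteq> i" "w \<noteq> j" "S' u \<subset> S w" "S w \<subset> S' j"
      have "S w \<inter> S j \<noteq> {}" using w(4) uK ne[OF uK(1)] by auto
      then have "S w \<subset> S j \<or> S j \<subset> S w" using laminar_onD[OF lam w(1) jK _ w(3)] by blast
      then show False using treeD(5)[OF u w(1)] treeD(5)[OF ji w(1)] w S'j by simp blast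
    qed (use S'j uK Sji in auto)
  qed
  show "(u, i) \<in> tree K S'" if u: "(u, i) \<in> tree K S" "u \<noteq> j"
  proof -
    have uK: "u \<in> K" "S u \<subset> S i" "u \<noteq> i" using treeD[OF u(1)] by auto
    then have [simp]: "S' u = S u" using other u by simp
    have "S u \<inter> S j = {}" using tree_disjoint[OF lam u(1) ji u(2)] .
    moreover have "p \<notin> S u" using p uK by auto
    ultimately have sub: "S' u \<subset> S' i" using p(1) pj uK S'i by auto
    show ?thesis
    proof (rule treeI'[OF uK(1) iK sub])
      fix w assume w: "w \<in> K" "w \<noteq> i" "w \<noteq> j" "S' u \<subset> S w" "S w \<subset> S' i"
      then have "S u \<subset> S w" "S w \<subset> S i" using S'i by auto
      then show False using treeD(5)[OF u(1) w(1)] by simp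
    qed (use S'i in auto)
  qed
  show "(u, v) \<in> tree K S'" if u: "(u, v) \<in> tree K S" "u \<notin> {i, j}" "v \<notin> {i, j}"
  proof (rule unchangedI[OF u])
    assume b: "S u \<subset> S' i" "S' i \<subset> S v"
    have vK: "v \<in> K" "v \<noteq> i" using treeD[OF u(1)] u by auto
    have "p \<in> S v" using b p(1) pj S'i by auto
    then have "S v \<subset> S i \<or> S i \<subset> S v" using laminar_onD[OF lam vK(1) iK _ vK(2)] p(1) by blast
    then have "S i \<subset> S v" using p(2)[OF vK(1)] \<open>p \<in> S v\<close> by blast
    moreover have "S u \<subset> S i" using b S'i by blast
    ultimately show False using treeD(5)[OF u(1) iK] by simp
  qed
qed

text \<open>The same use of the gap, now that of the parent \<open>j\<close>: a member other than
  \<open>j\<close> that contains \<open>p\<close> lies strictly above \<open>S j\<close>, hence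
  above both pieces into which \<open>S j\<close> is cut.\<close>

lemma child_of_parent:
  assumes ij: "(i, j) \<in> tree K S" and jk: "(j, k) \<in> tree K S"
    and S'i: "S' i = S j - S i"
    and p: "p \<in> S j" "\<And>w. w \<in> K \<Longrightarrow> S w \<subset> S j \<Longrightarrow> p \<notin> S w"
  shows "(i, k) \<in> tree K S'" "(j, k) \<in> tree K S'"
    and "(u, j) \<in> tree K S \<Longrightarrow> u \<noteq> i \<Longrightarrow> (u, i) \<in> tree K S'"
    and "(u, i) \<in> tree K S \<Longrightarrow> (u, j) \<in> tree K S'"
    and "(u, v) \<in> tree K S \<Longrightarrow> u \<notin> {i, j} \<Longrightarrow> v \<notin> {i, j} \<Longrightarrow> (u, v) \<in> tree K S'"
proof -
  have kK: "k \<in> K" and Sjk: "S j \<subset> S k" and Sij: "S i \<subset> S j"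
    using treeD[OF ij] treeD[OF jk] by auto
  have knij: "k \<noteq> i" "k \<noteq> j" using Sjk Sij by auto
  have [simp]: "S' k = S k" using other knij by simp
  have pi: "p \<notin> S i" using p(2)[OF iK Sij] .
  have ne: "S u \<noteq> {}" if "u \<in> K" for u using that lam by (simp add: laminar_on_def)
  have above: "S j \<subset> S w" if "w \<in> K" "w \<noteq> j" "p \<in> S w" for w
  proof -
    have "S w \<subset> S j \<or> S j \<subset> S w" using laminar_onD[OF lam that(1) jK _ that(2)] p(1) that(3)
      by blast
    then show ?thesis using p(2)[OF that(1)] that(3) by blast
  qed
  show "(i, k) \<in> tree K S'"
  proof (rule treeI'[OF iK kK])
    fix w assume w: "w \<in> K" "w \<noteq> i" "w \<noteq> j" "S' i \<subset> S w" "S w \<subset> S' k"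
    have "p \<in> S w" using w(4) p(1) pi S'i by blast
    then have "S j \<subset> S w" using above w by simp
    then show False using treeD(5)[OF jk w(1)] w by simp
  qed (use S'i Sjk ne[OF iK] p pi in auto)
  show "(j, k) \<in> tree K S'"
  proof (rule treeI'[OF jK kK])
    fix w assume w: "w \<in> K" "w \<noteq> i" "w \<noteq> j" "S' j \<subset> S w" "S w \<subset> S' k"
    have "S w \<inter> S j \<noteq> {}" using w(4) Sij ne[OF iK] S'j by auto
    then have "S w \<subset> S j \<or> S j \<subset> S w" using laminar_onD[OF lam w(1) jK _ w(3)] by blast
    then show False using treeD(5)[OF ij w(1)] treeD(5)[OF jk w(1)] w S'j by simp blast
  qed (use S'i S'j Sjk Sij ne[OF iK] in auto)
  show "(u, i) \<in> tree K S'" if u: "(u, j) \<in> tree K S" "u \<noteq> i"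
  proof -
    have uK: "u \<in> K" "S u \<subset> S j" "u \<noteq> j" using treeD[OF u(1)] by auto
    then have [simp]: "S' u = S u" using other u by simp
    have "S u \<inter> S i = {}" using tree_disjoint[OF lam u(1) ij u(2)] .
    moreover have "p \<notin> S u" using p uK by auto
    ultimately have sub: "S' u \<subset> S' i" using p(1) pi uK S'i by auto
    show ?thesis
    proof (rule treeI'[OF uK(1) iK sub])
      fix w assume w: "w \<in> K" "w \<noteq> i" "w \<noteq> j" "S' u \<subset> S w" "S w \<subset> S' i"
      then have "S u \<subset> S w" "S w \<subset> S j" using S'i by auto
      then show False using treeD(5)[OF u(1) w(1)] by simp
    qed (use S'i ne[OF iK] in auto)
  qed
  show "(u, j) \<in> tree K S'" if u: "(u, i) \<in> tree K S"
  proof -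
    have uK: "u \<in> K" "S u \<subset> S i" using treeD[OF u] by auto
    have un: "u \<noteq> i" "u \<noteq> j" using uK Sij by auto
    then have [simp]: "S' u = S u" using other by simp
    show ?thesis
    proof (rule treeI'[OF uK(1) jK])
      show "S' u \<subset> S' i \<Longrightarrow> S' i \<subset> S' j \<Longrightarrow> False" using S'i uK ne[OF uK(1)] by auto
      fix w assume w: "w \<in> K" "w \<noteq> i" "w \<noteq> j" "S' u \<subset> S w" "S w \<subset> S' j"
      then show False using treeD(5)[OF u w(1)] S'j by simp
    qed (use S'j uK in auto)
  qed
  show "(u, v) \<in> tree K S'" if u: "(u, v) \<in> tree K S" "u \<notin> {i, j}" "v \<notin> {i, j}"
  proof (rule unchangedI[OF u])
    assume b: "S u \<subset> S' i" "S' i \<subset> S v"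
    have vK: "v \<in> K" "v \<noteq> j" using treeD[OF u(1)] u by auto
    have "p \<in> S v" using b p(1) pi S'i by auto
    then have "S j \<subset> S v" using above vK by simp
    moreover have "S u \<subset> S j" using b S'i by blast
    ultimately show False using treeD(5)[OF u(1) jK] by simp
  qed
qed

text \<open>A node under the union was under one of the two disjoint parts, and a node above one
  part contains the common parent \<open>k\<close>. So \<open>S' i\<close> fits between
  \<open>k\<close> and the two old siblings without disturbing other edges.\<close>

lemma siblings_merge:
  assumes ik: "(i, k) \<in> tree K S" and jk: "(j, k) \<in> tree K S"
    and S'i: "S' i = S i \<union> S j"
  shows "(i, k) \<in> tree K S'" "(j, i) \<in> tree K S'"
    and "(u, j) \<in> tree K S \<Longrightarrow> (u, i) \<in> tree K S'"
    and "(u, i) \<in> tree K S \<Longrightarrow> (u, j) \<in> tree K S'"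
    and "(u, v) \<in> tree K S \<Longrightarrow> u \<notin> {i, j} \<Longrightarrow> v \<notin> {i, j} \<Longrightarrow> (u, v) \<in> tree K S'"
proof -
  have kK: "k \<in> K" and Sjk: "S j \<subset> S k" and Sik: "S i \<subset> S k"
    using treeD[OF ik] treeD[OF jk] by auto
  have knij: "k \<noteq> i" "k \<noteq> j" using Sjk Sik by auto
  have [simp]: "S' k = S k" using other knij by simp
  have disj: "S i \<inter> S j = {}" using tree_disjoint[OF lam ik jk neq] .
  have ne: "S u \<noteq> {}" if "u \<in> K" for u using that lam by (simp add: laminar_on_def)
  \<comment> \<open>The union could a priori exhaust \<open>S k\<close>; this is excluded because
    distinct labels of the new laminar family carry distinct sets.\<close>
  have S'ik: "S' i \<subset> S k"
  proof -
    have "S' i \<inter> S' k \<noteq> {}" using Sik S'i ne[OF iK] by auto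
    then have "S' i \<subset> S' k \<or> S' k \<subset> S' i" using laminar_onD[OF lam' iK kK] knij by blast
    moreover have "\<not> S k \<subset> S' i"
    proof
      assume k: "S k \<subset> S' i"
      then show False using S'i Sik Sjk by blast
    qed
    ultimately show ?thesis by simp
  qed
  show "(i, k) \<in> tree K S'"
  proof (rule treeI'[OF iK kK])
    fix w assume w: "w \<in> K" "w \<noteq> i" "w \<noteq> j" "S' i \<subset> S w" "S w \<subset> S' k"
    have "S i \<subset> S w" using w(4) S'i by blast
    then show False using treeD(5)[OF ik w(1)] w by simp
  qed (use S'ik S'i in auto)
  show "(j, i) \<in> tree K S'"
  proof (rule treeI'[OF jK iK])
    show "S' j \<subset> S' i" using S'i S'j disj ne[OF jK] by auto
    fix w assume w: "w \<in> K" "w \<noteq> i" "w \<noteq> j" "S' j \<subset> S w" "S w \<subset> S' i"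
    have "S w \<subset> S k" using w(5) S'ik by blast
    then show False using treeD(5)[OF ik w(1)] w(4) S'j by simp
  qed (use S'j in auto)
  show "(u, i) \<in> tree K S'" if u: "(u, j) \<in> tree K S"
  proof -
    have uK: "u \<in> K" "S u \<subset> S j" "u \<noteq> j" using treeD[OF u] by auto
    have "u \<noteq> i" using uK disj ne[OF iK] by auto
    then have [simp]: "S' u = S u" using other uK by simp
    show ?thesis
    proof (rule treeI'[OF uK(1) iK])
      show "S' u \<subset> S i \<Longrightarrow> S i \<subset> S' i \<Longrightarrow> False" using uK disj ne[OF uK(1)] by auto
      fix w assume w: "w \<in> K" "w \<noteq> i" "w \<noteq> j" "S' u \<subset> S w" "S w \<subset> S' i"
      have "S w \<inter> S j \<noteq> {}" using w(4) uK ne[OF uK(1)] by auto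
      then have "S w \<subset> S j \<or> S j \<subset> S w" using laminar_onD[OF lam w(1) jK _ w(3)] by blast
      moreover have "S w \<subset> S k" using w(5) S'ik by blast
      ultimately show False using treeD(5)[OF u w(1)] treeD(5)[OF jk w(1)] w(4) by simp blast
    qed (use S'i uK in auto)
  qed
  show "(u, j) \<in> tree K S'" if u: "(u, i) \<in> tree K S"
  proof -
    have uK: "u \<in> K" "S u \<subset> S i" "u \<noteq> i" using treeD[OF u] by auto
    have "u \<noteq> j" using uK disj ne[OF jK] by auto
    then have [simp]: "S' u = S u" using other uK by simp
    show ?thesis
    proof (rule treeI'[OF uK(1) jK])
      fix w assume w: "w \<in> K" "w \<noteq> i" "w \<noteq> j" "S' u \<subset> S w" "S w \<subset> S' j"
      then show False using treeD(5)[OF u w(1)] S'j by simp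
    qed (use S'i S'j uK in auto)
  qed
  show "(u, v) \<in> tree K S'" if u: "(u, v) \<in> tree K S" "u \<notin> {i, j}" "v \<notin> {i, j}"
  proof (rule unchangedI[OF u])
    assume b: "S u \<subset> S' i" "S' i \<subset> S v"
    have uK: "u \<in> K" "v \<in> K" using treeD[OF u(1)] by auto
    have "S i \<subset> S v" using b S'i by blast
    then have kv: "S k \<subseteq> S v" using tree_parent_least[OF lam ik uK(2)] by simp
    have "S u \<subset> S k" using b S'ik by blast
    then have "\<not> S k \<subset> S v" using treeD(5)[OF u(1) kK] by blast
    then have "S k = S v" using kv by blast
    then have "(u, k) \<in> tree K S" using u(1) kK by (auto simp: tree_def)
    then have "S u \<inter> S i = {}" "S u \<inter> S j = {}"
      using tree_disjoint[OF lam _ ik] tree_disjoint[OF lam _ jk] u(2) by auto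
    then show False using b(1) S'i ne[OF uK(1)] by auto
  qed
qed

end


section \<open>Mutation of interval sequences\<close>

lemma (in interval_seq) laminar_on: "laminar_on K S"
  unfolding laminar_on_def using fin S_nonempty finite_S laminar by blast

text \<open>Only pairs with the new interval have to be checked. Since \<open>before\<close> and
  \<open>after\<close> quantify over arbitrary intervals, each case of the mutation reduces to
  inequalities between end points of the two old ones.\<close>

lemma interval_seq_replace:
  assumes "interval_seq {1..n} n l r" "1 \<le> i" "i < n" "1 \<le> a" "a \<le> b" "b \<le> n"
    and before: "\<And>c d. \<lbrakk>c \<le> d; compat c d (l i) (r i); compat c d (l (Suc i)) (r (Suc i))\<rbrakk>
        \<Longrightarrow> compat c d a b"
    and after: "\<And>c d. \<lbrakk>c \<le> d; compat (l i) (r i) c d; compat (l (Suc i)) (r (Suc i)) c d\<rbrakk>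
        \<Longrightarrow> compat a b c d"
    and pair: "compat a b (l i) (r i)"
  shows "interval_seq {1..n} n (l(i := a, Suc i := l i)) (r(i := b, Suc i := r i))"
proof -
  interpret interval_seq "{1..n}" n l r by fact
  let ?l = "l(i := a, Suc i := l i)" and ?r = "r(i := b, Suc i := r i)"
  show ?thesis
  proof
    fix k assume "k \<in> {1..n}"
    then show "1 \<le> ?l k \<and> ?l k \<le> ?r k \<and> ?r k \<le> n"
      using bounds[of k] bounds[of i] assms by auto
  next
    fix x y assume xy: "x \<in> {1..n}" "y \<in> {1..n}" "x < y"
    have bx: "l x \<le> r x" and by': "l y \<le> r y" using bounds xy by auto
    have cx: "compat (l x) (r x) (l m) (r m)" if "x < m" "m \<in> {1..n}" for m
      using comp[OF xy(1) that(2,1)] .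
    have cy: "compat (l m) (r m) (l y) (r y)" if "m < y" "m \<in> {1..n}" for m
      using comp[OF that(2) xy(2) that(1)] .
    have K: "i \<in> {1..n}" "Suc i \<in> {1..n}" using assms by auto
    consider "x < i" "y = i" | "x < i" "y = Suc i" | "x = i" "y = Suc i" | "x = i" "y > Suc i"
      | "x = Suc i" "y > Suc i" | "x \<notin> {i, Suc i}" "y \<notin> {i, Suc i}"
      using xy by (cases "x < i"; cases "y > Suc i"; force)
    then show "compat (?l x) (?r x) (?l y) (?r y)"
    proof cases
      case 1
      then show ?thesis using before[OF bx cx[OF _ K(1)] cx[OF _ K(2)]] by simp
    next
      case 2
      then show ?thesis using cx[OF _ K(1)] by simp
    next
      case 3
      then show ?thesis using pair by simp
    next
      case 4
      then show ?thesis using after[OF by' cy[OF _ K(1)] cy[OF _ K(2)]] by simp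
    next
      case 5
      then show ?thesis using cy[OF _ K(1)] by simp
    next
      case 6
      then show ?thesis using cx[OF xy(3,2)] by simp
    qed
  qed simp
qed

text \<open>Otherwise the second interval could be inserted right after the first one; doubling the
  indices makes room for it, and the sequence of \<open>n + 1\<close> intervals contradicts
  \<open>card_le\<close>.\<close>

lemma interval_seq_insert:
  assumes "interval_seq {1..n} n (l(i := a)) (r(i := b))"
    and "interval_seq {1..n} n (l(i := c)) (r(i := d))"
    and "i \<in> {1..n}"
  shows "\<not> compat a b c d"
proof
  assume cp: "compat a b c d"
  interpret X: interval_seq "{1..n}" n "l(i := a)" "r(i := b)" by fact
  interpret Y: interval_seq "{1..n}" n "l(i := c)" "r(i := d)" by fact
  let ?K = "(*) 2 ` {1..n} \<union> {Suc (2 * i)}"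
  let ?l = "\<lambda>m. if m = Suc (2 * i) then c else (l(i := a)) (m div 2)"
  let ?r = "\<lambda>m. if m = Suc (2 * i) then d else (r(i := b)) (m div 2)"
  have odd: "2 * m \<noteq> Suc (2 * i)" for m by presburger
  interpret I: interval_seq ?K n ?l ?r
  proof
    fix k assume "k \<in> ?K"
    then show "1 \<le> ?l k \<and> ?l k \<le> ?r k \<and> ?r k \<le> n"
      using X.bounds Y.bounds[of i] assms(3) odd by fastforce
  next
    fix x y assume xy: "x \<in> ?K" "y \<in> ?K" "x < y"
    consider u v where "x = 2 * u" "y = 2 * v" "u \<in> {1..n}" "v \<in> {1..n}"
      | u where "x = 2 * u" "u \<in> {1..n}" "y = Suc (2 * i)"
      | v where "x = Suc (2 * i)" "y = 2 * v" "v \<in> {1..n}"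
      using xy by blast
    then show "compat (?l x) (?r x) (?l y) (?r y)"
    proof cases
      case (1 u v)
      then show ?thesis using X.comp[of u v] xy(3) odd by auto
    next
      case (2 u)
      then show ?thesis using Y.comp[of u i] cp xy(3) odd assms(3) by (cases "u = i") auto
    next
      case (3 v)
      then show ?thesis using Y.comp[of i v] xy(3) odd assms(3) by auto
    qed
  qed simp
  have "card ((*) 2 ` {1..n}) = n" by (subst card_image) (auto simp: inj_on_def)
  moreover have "Suc (2 * i) \<notin> (*) 2 ` {1..n}" using odd by force
  ultimately have "card ?K = Suc n" by simp
  then show False using I.card_le by simp
qed

section \<open>Uniqueness of the new interval\<close>

lemma compat_hull_right:
  assumes "e \<le> f" "a < c" "c \<le> b" "b < d" "compat e f a b" "compat e f c d"
  shows "compat e f a d"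
  using assms by (auto simp: compat_iff)

lemma compat_hull_left:
  assumes "e \<le> f" "a < c" "c \<le> b" "b < d" "compat a b e f" "compat c d e f"
  shows "compat a d e f"
  using assms by (auto simp: compat_iff)

text \<open>If two candidates cross, their hull \<open>[a, d]\<close> is a candidate as well. It
  shares the left end point with \<open>[a, b]\<close>, so \<open>[a, b]\<close> could be inserted
  after it.\<close>

lemma interval_seq_no_crossing:
  assumes X: "interval_seq {1..n} n (l(i := a)) (r(i := b))"
    and Y: "interval_seq {1..n} n (l(i := c)) (r(i := d))"
    and i: "i \<in> {1..n}"
  shows "\<not> (a < c \<and> c \<le> b \<and> b < d)"
proof
  assume cr: "a < c \<and> c \<le> b \<and> b < d"
  interpret X: interval_seq "{1..n}" n "l(i := a)" "r(i := b)" by fact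
  interpret Y: interval_seq "{1..n}" n "l(i := c)" "r(i := d)" by fact
  have "interval_seq {1..n} n (l(i := a)) (r(i := d))"
  proof
    fix k assume "k \<in> {1..n}"
    then show "1 \<le> (l(i := a)) k \<and> (l(i := a)) k \<le> (r(i := d)) k \<and> (r(i := d)) k \<le> n"
      using X.bounds[of k] Y.bounds[of k] cr by auto
  next
    fix x y assume xy: "x \<in> {1..n}" "y \<in> {1..n}" "x < y"
    then show "compat ((l(i := a)) x) ((r(i := d)) x) ((l(i := a)) y) ((r(i := d)) y)"
      using X.comp[OF xy] Y.comp[OF xy] cr X.bounds[OF xy(1)] X.bounds[OF xy(2)]
        compat_hull_right[of "l x" "r x" a c b d] compat_hull_left[of "l y" "r y" a c b d]
      by (auto split: if_splits)
  qed simp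
  moreover have "compat a d a b" using cr by (simp add: compat_def)
  ultimately show False using interval_seq_insert[OF _ X i] by blast
qed

text \<open>Two different candidates that do not cross are nested or disjoint, hence compatible in
  at least one order, and one could be inserted after the other.\<close>

lemma interval_seq_unique:
  assumes X: "interval_seq {1..n} n (l(i := a)) (r(i := b))"
    and Y: "interval_seq {1..n} n (l(i := c)) (r(i := d))"
    and i: "i \<in> {1..n}"
  shows "a = c \<and> b = d"
proof -
  interpret X: interval_seq "{1..n}" n "l(i := a)" "r(i := b)" by fact
  interpret Y: interval_seq "{1..n}" n "l(i := c)" "r(i := d)" by fact
  have "a \<le> b" "c \<le> d" using X.bounds[OF i] Y.bounds[OF i] by auto
  then show ?thesis
    using interval_seq_insert[OF X Y i] interval_seq_insert[OF Y X i]
      interval_seq_no_crossing[OF X Y i] interval_seq_no_crossing[OF Y X i]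
    by (auto simp: compat_iff)
qed

text \<open>With the interval \<open>[1, n + 1]\<close> at position \<open>0\<close>, the master root becomes an ordinary
  node, belonging to a complete sequence for \<open>A\<^sub>n\<^sub>+\<^sub>1\<close>.\<close>

lemma interval_seq_extend:
  assumes "interval_seq {1..n} n l r"
  shows "complete_interval_seq {0..n} (Suc n) (l(0 := 1)) (r(0 := Suc n))"
proof -
  interpret interval_seq "{1..n}" n l r by fact
  show ?thesis
  proof
    fix k assume "k \<in> {0..n}"
    then show "1 \<le> (l(0 := 1)) k \<and> (l(0 := 1)) k \<le> (r(0 := Suc n)) k \<and> (r(0 := Suc n)) k \<le> Suc n"
      using bounds[of k] by (cases "k = 0") auto
  next
    fix x y :: nat assume xy: "x \<in> {0..n}" "y \<in> {0..n}" "x < y"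
    then show "compat ((l(0 := 1)) x) ((r(0 := Suc n)) x) ((l(0 := 1)) y) ((r(0 := Suc n)) y)"
      using comp[of x y] bounds[of y] by (cases "x = 0") (auto simp: compat_iff)
  qed auto
qed

context interval_seq
begin

text \<open>An interval in between would share the left end point with both and thus need a position
  strictly between \<open>i\<close> and \<open>Suc i\<close>. This lemma and the next two show that
  nodes which are not close have no common or adjacent end points forcing their order.\<close>

lemma same_left_parent_child:
  assumes K: "i \<in> K" "Suc i \<in> K" and "S (Suc i) \<subset> S i" "l i = l (Suc i)"
  shows "(Suc i, i) \<in> tree K S"
proof (rule treeI[OF K(2,1) assms(3)])
  fix w assume w: "w \<in> K" "S (Suc i) \<subset> S w" "S w \<subset> S i"
  have "l w = l i"
    using w K bounds[OF K(1)] bounds[OF K(2)] bounds[OF w(1)] assms(4)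
    by (auto simp: ivals_def atLeastatMost_psubset_iff)
  then have "i < w" "w < Suc i"
    using order_same_left[of i w] order_same_left[of w "Suc i"] w K assms(4) by auto
  then show False by simp
qed

lemma same_right_child_parent:
  assumes K: "i \<in> K" "Suc i \<in> K" and "S i \<subset> S (Suc i)" "r i = r (Suc i)"
  shows "(i, Suc i) \<in> tree K S"
proof (rule treeI[OF K assms(3)])
  fix w assume w: "w \<in> K" "S i \<subset> S w" "S w \<subset> S (Suc i)"
  have "r w = r i"
    using w K bounds[OF K(1)] bounds[OF K(2)] bounds[OF w(1)] assms(4)
    by (auto simp: ivals_def atLeastatMost_psubset_iff)
  then have "i < w" "w < Suc i"
    using order_same_right[of w i] order_same_right[of "Suc i" w] w K assms(4) by auto
  then show False by simp
qed

text \<open>An interval strictly around one of the two but not around the other would end or begin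
  where they touch. It is then ordered against both and would need a position strictly between them,
  so both have the same intervals above them.\<close>

lemma adjacent_siblings:
  assumes K: "Suc i \<in> K" and ik: "(i, k) \<in> tree K S" and adj: "r i + 1 = l (Suc i)"
  shows "(Suc i, k) \<in> tree K S"
proof -
  have iK: "i \<in> K" "k \<in> K" "S i \<subset> S k" using treeD[OF ik] by auto
  have b: "l i \<le> r i" "l (Suc i) \<le> r (Suc i)" using bounds[OF iK(1)] bounds[OF K] by auto
  have *: "S (Suc i) \<subset> S w" if w: "w \<in> K" "S i \<subset> S w" for w
  proof (rule ccontr)
    assume n: "\<not> S (Suc i) \<subset> S w"
    have ri: "l w \<le> r i" "r i \<le> r w" using w b by (auto simp: ivals_def)
    have "\<not> S w \<subset> S (Suc i)" using ri adj by (auto simp: ivals_def)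
    moreover have "w \<noteq> Suc i" using ri adj by auto
    ultimately have "S (Suc i) \<inter> S w = {}" using laminar[OF K w(1)] n by blast
    then have "r w = r i" using ri adj b bounds[OF w(1)] by (auto simp: ivals_def interval_disjoint)
    then have "i < w" "w < Suc i"
      using order_same_right[of w i] order_adjacent[of w "Suc i"] w iK K adj by auto
    then show False by simp
  qed
  have **: "S i \<subset> S w" if w: "w \<in> K" "S (Suc i) \<subset> S w" for w
  proof (rule ccontr)
    assume n: "\<not> S i \<subset> S w"
    have li: "l w \<le> l (Suc i)" "l (Suc i) \<le> r w" using w b by (auto simp: ivals_def)
    have "\<not> S w \<subset> S i" using li adj by (auto simp: ivals_def)
    moreover have "w \<noteq> i" using li adj by auto
    ultimately have "S i \<inter> S w = {}" using laminar[OF iK(1) w(1)] n by blast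
    then have "l w = l (Suc i)" using li adj b bounds[OF w(1)] by (auto simp: ivals_def interval_disjoint)
    then have "i < w" "w < Suc i"
      using order_same_left[of w "Suc i"] order_adjacent[of i w] w iK K adj by auto
    then show False by simp
  qed
  show ?thesis
  proof (rule treeI[OF K iK(2) *[OF iK(2,3)]])
    fix w assume w: "w \<in> K" "S (Suc i) \<subset> S w" "S w \<subset> S k"
    then show False using treeD(5)[OF ik w(1) **[OF w(1,2)]] by simp
  qed
qed

end

lemma laminar_on_eqD:
  assumes "laminar_on K S" "u \<in> K" "v \<in> K" "S u = S v"
  shows "u = v"
  using assms unfolding laminar_on_def by (metis inf.idem psubset_eq)

lemma parent_eq:
  assumes "laminar_on K S" "(u, k) \<in> tree K S"
  shows "parent (tree K S) u = k"
  unfolding parent_def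
  using assms single_valuedD[OF single_valued_tree[OF assms(1)]] by (intro the_equality) auto

text \<open>The master root is modelled as an ordinary node \<open>z\<close> above all others,
  untouched by the mutation; it ensures that every other node has a parent.\<close>

locale rooted_mutation = mutation K S S' i "Suc i" for K S S' i +
  fixes z :: nat
  assumes zK: "z \<in> K" and z: "z \<noteq> i" "z \<noteq> Suc i"
    and root: "\<And>u. u \<in> K \<Longrightarrow> S u \<subseteq> S z" and root': "\<And>u. u \<in> K \<Longrightarrow> S' u \<subseteq> S' z"
begin

text \<open>Supplies the last premise of \<open>sub_single_valued_eq\<close> for unchanged nodes;
  the parents of \<open>i\<close> and \<open>Suc i\<close> are listed explicitly in each
  case.\<close>

lemma has_parent:
  assumes "(u, v) \<in> tree K S'" "u \<notin> {i, Suc i}"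
  shows "\<exists>w. (u, w) \<in> tree K S"
proof -
  have uK: "u \<in> K" using treeD[OF assms(1)] by simp
  have "S' u \<subset> S' z" using treeD(2,3)[OF assms(1)] root'[of v] by blast
  then have "S u \<subset> S z" using assms(2) other[of u] other[of z] z by simp
  then show ?thesis using tree_parent_exists[OF lam uK zK] by blast
qed

lemma sigma_tree_parent_child:
  assumes ji: "(Suc i, i) \<in> tree K S"
    and S'i: "S' i = S i - S (Suc i)"
    and p: "p \<in> S i" "\<And>w. w \<in> K \<Longrightarrow> S w \<subset> S i \<Longrightarrow> p \<notin> S w"
  shows "sigma_tree i (tree K S) = tree K S'"
proof -
  have "S i \<noteq> S z" using laminar_on_eqD[OF lam iK zK] z(1) by blast
  then have "S i \<subset> S z" using root[OF iK] by blast
  then obtain k where ik: "(i, k) \<in> tree K S" using tree_parent_exists[OF lam iK zK] by blast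
  note M = parent_of_child[OF ji ik S'i p]
  let ?T = "tree K S"
  have eq: "sigma_tree i ?T = {(u, v) \<in> ?T. u \<notin> {i, Suc i} \<and> v \<notin> {i, Suc i}} \<union> {(Suc i, k)}
      \<union> (children ?T (Suc i) \<union> {i}) \<times> {Suc i} \<union> (children ?T i - {Suc i}) \<times> {i}"
    using ji parent_eq[OF lam ik] by (simp add: sigma_tree_def close_def Let_def)
  show ?thesis unfolding eq
  proof (rule sub_single_valued_eq)
    show "single_valued (tree K S')" by (rule single_valued_tree[OF lam'])
    show "{(u, v) \<in> ?T. u \<notin> {i, Suc i} \<and> v \<notin> {i, Suc i}} \<union> {(Suc i, k)}
      \<union> (children ?T (Suc i) \<union> {i}) \<times> {Suc i} \<union> (children ?T i - {Suc i}) \<times> {i} \<subseteq> tree K S'"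
      using M by (auto simp: children_def)
    fix u v assume "(u, v) \<in> tree K S'"
    then have "u \<notin> {i, Suc i} \<Longrightarrow> \<exists>w. (u, w) \<in> ?T" by (rule has_parent)
    then show "\<exists>w. (u, w) \<in> {(u, v) \<in> ?T. u \<notin> {i, Suc i} \<and> v \<notin> {i, Suc i}} \<union> {(Suc i, k)}
      \<union> (children ?T (Suc i) \<union> {i}) \<times> {Suc i} \<union> (children ?T i - {Suc i}) \<times> {i}"
      unfolding children_def by blast
  qed
qed

lemma sigma_tree_child_parent:
  assumes ij: "(i, Suc i) \<in> tree K S"
    and S'i: "S' i = S (Suc i) - S i"
    and p: "p \<in> S (Suc i)" "\<And>w. w \<in> K \<Longrightarrow> S w \<subset> S (Suc i) \<Longrightarrow> p \<notin> S w"
  shows "sigma_tree i (tree K S) = tree K S'"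
proof -
  have "S (Suc i) \<noteq> S z" using laminar_on_eqD[OF lam jK zK] z(2) by blast
  then have "S (Suc i) \<subset> S z" using root[OF jK] by blast
  then obtain k where jk: "(Suc i, k) \<in> tree K S" using tree_parent_exists[OF lam jK zK] by blast
  note M = child_of_parent[OF ij jk S'i p]
  let ?T = "tree K S"
  \<comment> \<open>\<open>sigma_tree\<close> tests this edge first, so its branch has to be
    excluded.\<close>
  have "(Suc i, i) \<notin> ?T" using treeD(3)[OF ij] treeD(3)[of "Suc i" i K S] by blast
  then have eq: "sigma_tree i ?T = {(u, v) \<in> ?T. u \<notin> {i, Suc i} \<and> v \<notin> {i, Suc i}}
      \<union> {(i, k), (Suc i, k)}
      \<union> (children ?T (Suc i) - {i}) \<times> {i} \<union> children ?T i \<times> {Suc i}"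
    using ij parent_eq[OF lam jk] by (simp add: sigma_tree_def close_def Let_def)
  show ?thesis unfolding eq
  proof (rule sub_single_valued_eq)
    show "single_valued (tree K S')" by (rule single_valued_tree[OF lam'])
    show "{(u, v) \<in> ?T. u \<notin> {i, Suc i} \<and> v \<notin> {i, Suc i}} \<union> {(i, k), (Suc i, k)}
      \<union> (children ?T (Suc i) - {i}) \<times> {i} \<union> children ?T i \<times> {Suc i} \<subseteq> tree K S'"
      using M by (auto simp: children_def)
    fix u v assume "(u, v) \<in> tree K S'"
    then have "u \<notin> {i, Suc i} \<Longrightarrow> \<exists>w. (u, w) \<in> ?T" by (rule has_parent)
    then show "\<exists>w. (u, w) \<in> {(u, v) \<in> ?T. u \<notin> {i, Suc i} \<and> v \<notin> {i, Suc i}}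
      \<union> {(i, k), (Suc i, k)}
      \<union> (children ?T (Suc i) - {i}) \<times> {i} \<union> children ?T i \<times> {Suc i}"
      unfolding children_def by blast
  qed
qed

lemma sigma_tree_siblings:
  assumes ik: "(i, k) \<in> tree K S" and jk: "(Suc i, k) \<in> tree K S"
    and S'i: "S' i = S i \<union> S (Suc i)"
  shows "sigma_tree i (tree K S) = tree K S'"
proof -
  note M = siblings_merge[OF ik jk S'i]
  let ?T = "tree K S"
  have "S i \<inter> S (Suc i) = {}" using tree_disjoint[OF lam ik jk] by simp
  then have "(Suc i, i) \<notin> ?T" "(i, Suc i) \<notin> ?T"
    using treeD(3)[of "Suc i" i K S] treeD(3)[of i "Suc i" K S] lam iK jK
    unfolding laminar_on_def by blast+
  moreover have "close ?T i (Suc i)" using ik jk by (auto simp: close_def siblings_def)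
  ultimately have eq: "sigma_tree i ?T = {(u, v) \<in> ?T. u \<notin> {i, Suc i} \<and> v \<notin> {i, Suc i}}
      \<union> {(i, k)} \<union> (children ?T (Suc i) \<union> {Suc i}) \<times> {i} \<union> children ?T i \<times> {Suc i}"
    using parent_eq[OF lam ik] by (simp add: sigma_tree_def Let_def)
  show ?thesis unfolding eq
  proof (rule sub_single_valued_eq)
    show "single_valued (tree K S')" by (rule single_valued_tree[OF lam'])
    show "{(u, v) \<in> ?T. u \<notin> {i, Suc i} \<and> v \<notin> {i, Suc i}}
      \<union> {(i, k)} \<union> (children ?T (Suc i) \<union> {Suc i}) \<times> {i} \<union> children ?T i \<times> {Suc i} \<subseteq> tree K S'"
      using M by (auto simp: children_def)
    fix u v assume "(u, v) \<in> tree K S'"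
    then have "u \<notin> {i, Suc i} \<Longrightarrow> \<exists>w. (u, w) \<in> ?T" by (rule has_parent)
    then show "\<exists>w. (u, w) \<in> {(u, v) \<in> ?T. u \<notin> {i, Suc i} \<and> v \<notin> {i, Suc i}}
      \<union> {(i, k)} \<union> (children ?T (Suc i) \<union> {Suc i}) \<times> {i} \<union> children ?T i \<times> {Suc i}"
      unfolding children_def by blast
  qed
qed

text \<open>The new family is the old one composed with the transposition, so its Hasse diagram is
  the relabelled one.\<close>

lemma sigma_tree_not_close:
  assumes nc: "\<not> close (tree K S) i (Suc i)" and S'i: "S' i = S (Suc i)"
  shows "sigma_tree i (tree K S) = tree K S'"
proof -
  let ?t = "transpose i (Suc i)"
  have S': "S' u = S (?t u)" for u
    using other[of u] S'i S'j by (auto simp: transpose_def)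
  have tK: "?t u \<in> K \<longleftrightarrow> u \<in> K" for u using iK jK by (auto simp: transpose_def)
  have tree': "(u, v) \<in> tree K S' \<longleftrightarrow> (?t u, ?t v) \<in> tree K S" for u v
  proof -
    have "(\<exists>w\<in>K. S (?t u) \<subset> S (?t w) \<and> S (?t w) \<subset> S (?t v)) \<longleftrightarrow>
        (\<exists>w\<in>K. S (?t u) \<subset> S w \<and> S w \<subset> S (?t v))"
      using tK by (metis transpose_involutory)
    then show ?thesis unfolding tree_def by (simp only: mem_Collect_eq case_prod_conv S' tK)
  qed
  have "map_prod ?t ?t ` tree K S = tree K S'"
  proof (rule Set.set_eqI)
    fix x :: "nat \<times> nat"
    obtain u v where x: "x = (u, v)" by (cases x)
    show "x \<in> map_prod ?t ?t ` tree K S \<longleftrightarrow> x \<in> tree K S'"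
      unfolding x tree' by (force simp: map_prod_def image_iff)
  qed
  then show ?thesis using nc by (simp add: sigma_tree_def)
qed

end

text \<open>The exclusions are the three configurations in which the order of a compatible pair is
  forced.\<close>

lemma swap_compat:
  assumes "c \<le> d" "a \<le> b" "compat c d a b"
    and "\<not> ({a..b} \<subset> {c..d} \<and> c = a)" "\<not> ({c..d} \<subset> {a..b} \<and> d = b)" "d + 1 \<noteq> a"
  shows "compat a b c d"
  using assms by (auto simp: compat_iff atLeastatMost_psubset_iff)

theorem mutate_interval_seq:
  assumes seq: "interval_seq {1..n} n l r" and i: "1 \<le> i" "i < n"
  obtains a b where
    "interval_seq {1..n} n (l(i := a, Suc i := l i)) (r(i := b, Suc i := r i))"
    "sigma_tree i (tree {0..n} (ivals (l(0 := 1)) (r(0 := Suc n)))) =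
     tree {0..n} (ivals (l(i := a, Suc i := l i, 0 := 1)) (r(i := b, Suc i := r i, 0 := Suc n)))"
proof -
  interpret I: interval_seq "{1..n}" n l r by fact
  interpret C: complete_interval_seq "{0..n}" "Suc n" "l(0 := 1)" "r(0 := Suc n)"
    by (rule interval_seq_extend[OF seq])
  define S where "S = ivals (l(0 := 1)) (r(0 := Suc n))"
  define T where "T = tree {0..n} S"
  have K: "i \<in> {0..n}" "Suc i \<in> {0..n}" "0 \<in> {0..n}" using i by auto
  have Si: "S i = {l i..r i}" and Sj: "S (Suc i) = {l (Suc i)..r (Suc i)}"
    and S0: "S 0 = {1..Suc n}"
    using i by (auto simp: S_def ivals_def)
  have b: "1 \<le> l i" "l i \<le> r i" "r i \<le> n"
    "1 \<le> l (Suc i)" "l (Suc i) \<le> r (Suc i)" "r (Suc i) \<le> n"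
    using I.bounds[of i] I.bounds[of "Suc i"] i by auto
  have cmp: "compat (l i) (r i) (l (Suc i)) (r (Suc i))" using I.comp[of i "Suc i"] i by simp
  have gap: "C.gap k \<in> S k" "\<And>w. w \<in> {0..n} \<Longrightarrow> S w \<subset> S k \<Longrightarrow> C.gap k \<notin> S w"
    if "k \<in> {0..n}" for k
    using C.gap[OF that] unfolding C.covered_def S_def by blast+
  have rooted: "rooted_mutation {0..n} S
      (ivals (l(i := a, Suc i := l i, 0 := 1)) (r(i := b, Suc i := r i, 0 := Suc n))) i 0"
    if new: "interval_seq {1..n} n (l(i := a, Suc i := l i)) (r(i := b, Suc i := r i))" for a b
  proof -
    interpret C': complete_interval_seq "{0..n}" "Suc n" "l(i := a, Suc i := l i, 0 := 1)"
      "r(i := b, Suc i := r i, 0 := Suc n)"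
      by (rule interval_seq_extend[OF new])
    show ?thesis
    proof
      show "laminar_on {0..n} S" unfolding S_def by (rule C.laminar_on)
      show "laminar_on {0..n} (ivals (l(i := a, Suc i := l i, 0 := 1))
        (r(i := b, Suc i := r i, 0 := Suc n)))" by (rule C'.laminar_on)
      show "S u \<subseteq> S 0" if "u \<in> {0..n}" for u
        using C.bounds[OF that] by (auto simp: S_def ivals_def)
      show "ivals (l(i := a, Suc i := l i, 0 := 1)) (r(i := b, Suc i := r i, 0 := Suc n)) u
        \<subseteq> ivals (l(i := a, Suc i := l i, 0 := 1)) (r(i := b, Suc i := r i, 0 := Suc n)) 0"
        if "u \<in> {0..n}" for u
        using C'.bounds[OF that] by (auto simp: ivals_def)
    qed (use i in \<open>auto simp: S_def ivals_def\<close>)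
  qed
  have new_i: "ivals (l(i := a, Suc i := l i, 0 := 1)) (r(i := b, Suc i := r i, 0 := Suc n)) i
      = {a..b}" for a b
    using i by (simp add: ivals_def)
  note replace = interval_seq_replace[OF seq i]
  consider "\<not> close T i (Suc i)" | "(Suc i, i) \<in> T" | "(i, Suc i) \<in> T" | "siblings T i (Suc i)"
    by (auto simp: close_def)
  then show ?thesis
  proof cases
    case 1
    have "\<not> (S (Suc i) \<subset> S i \<and> l i = l (Suc i))"
      using 1 C.same_left_parent_child[OF K(1,2)] i by (auto simp: close_def T_def S_def)
    moreover have "\<not> (S i \<subset> S (Suc i) \<and> r i = r (Suc i))"
      using 1 C.same_right_child_parent[OF K(1,2)] i by (auto simp: close_def T_def S_def)
    moreover have "r i + 1 \<noteq> l (Suc i)"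
    proof
      assume adj: "r i + 1 = l (Suc i)"
      have "S i \<subset> S 0" using b by (auto simp: Si S0 atLeastatMost_psubset_iff)
      then obtain k where "(i, k) \<in> T"
        using tree_parent_exists[OF C.laminar_on K(1,3)] by (auto simp: T_def S_def)
      then have "(Suc i, k) \<in> T"
        using C.adjacent_siblings[OF K(2), of k] adj i by (auto simp: T_def S_def)
      then show False using 1 \<open>(i, k) \<in> T\<close> by (auto simp: close_def siblings_def)
    qed
    ultimately have sw: "compat (l (Suc i)) (r (Suc i)) (l i) (r i)"
      using swap_compat[OF b(2,5) cmp] by (auto simp: Si Sj)
    have new: "interval_seq {1..n} n (l(i := l (Suc i), Suc i := l i)) (r(i := r (Suc i), Suc i := r i))"
      by (rule replace) (use sw b in auto)
    interpret R: rooted_mutation "{0..n}" S "ivals (l(i := l (Suc i), Suc i := l i, 0 := 1))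
      (r(i := r (Suc i), Suc i := r i, 0 := Suc n))" i 0 by (rule rooted[OF new])
    show ?thesis
      by (rule that[OF new])
        (rule R.sigma_tree_not_close[OF 1[unfolded T_def], unfolded new_i Sj, OF refl, unfolded S_def])
  next
    case 2
    have left: "l (Suc i) = l i"
      using C.consecutive_parent_child[OF K(2)] 2 i by (simp add: T_def S_def)
    have "S (Suc i) \<subset> S i" using 2 treeD(3) by (auto simp: T_def)
    then have right: "r (Suc i) < r i" using left b by (auto simp: Si Sj atLeastatMost_psubset_iff)
    \<comment> \<open>Parent and child begin together, so their difference is a single interval,
      starting right after the child.\<close>
    have new: "interval_seq {1..n} n (l(i := Suc (r (Suc i)), Suc i := l i)) (r(i := r i, Suc i := r i))"
      by (rule replace) (use left right b in \<open>auto simp: compat_iff\<close>)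
    interpret R: rooted_mutation "{0..n}" S "ivals (l(i := Suc (r (Suc i)), Suc i := l i, 0 := 1))
      (r(i := r i, Suc i := r i, 0 := Suc n))" i 0 by (rule rooted[OF new])
    have "{Suc (r (Suc i))..r i} = S i - S (Suc i)" using left right b by (auto simp: Si Sj)
    then show ?thesis
      by (intro that[OF new] R.sigma_tree_parent_child[OF 2[unfolded T_def] _ gap[OF K(1)], unfolded new_i, unfolded S_def]) (simp only: S_def)
  next
    case 3
    have right: "r i = r (Suc i)"
      using C.consecutive_child_parent[OF K(2)] 3 i by (simp add: T_def S_def)
    have "S i \<subset> S (Suc i)" using 3 treeD(3) by (auto simp: T_def)
    then have left: "l (Suc i) < l i" using right b by (auto simp: Si Sj atLeastatMost_psubset_iff)
    \<comment> \<open>Parent and child end together, so the difference is the part before the child;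
      \<open>l (Suc i) < l i\<close> keeps the truncated subtraction honest.\<close>
    have new: "interval_seq {1..n} n (l(i := l (Suc i), Suc i := l i)) (r(i := l i - 1, Suc i := r i))"
      by (rule replace) (use left right b in \<open>auto simp: compat_iff\<close>)
    interpret R: rooted_mutation "{0..n}" S "ivals (l(i := l (Suc i), Suc i := l i, 0 := 1))
      (r(i := l i - 1, Suc i := r i, 0 := Suc n))" i 0 by (rule rooted[OF new])
    have "{l (Suc i)..l i - 1} = S (Suc i) - S i" using left right b by (auto simp: Si Sj)
    then show ?thesis
      by (intro that[OF new] R.sigma_tree_child_parent[OF 3[unfolded T_def] _ gap[OF K(2)], unfolded new_i, unfolded S_def]) (simp only: S_def)
  next
    case 4
    then obtain k where k: "(i, k) \<in> T" "(Suc i, k) \<in> T" by (auto simp: siblings_def)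
    have adj: "r i + 1 = l (Suc i)"
      using C.consecutive_siblings[of i k] k i by (simp add: T_def S_def)
    \<comment> \<open>Adjacency is what makes the union of the siblings an interval.\<close>
    have new: "interval_seq {1..n} n (l(i := l i, Suc i := l i)) (r(i := r (Suc i), Suc i := r i))"
      by (rule replace) (use adj b in \<open>auto simp: compat_iff\<close>)
    interpret R: rooted_mutation "{0..n}" S "ivals (l(i := l i, Suc i := l i, 0 := 1))
      (r(i := r (Suc i), Suc i := r i, 0 := Suc n))" i 0 by (rule rooted[OF new])
    have "{l i..r (Suc i)} = S i \<union> S (Suc i)" using adj b by (auto simp: Si Sj)
    then show ?thesis
      by (intro that[OF new] R.sigma_tree_siblings[OF k[unfolded T_def], unfolded new_i, unfolded S_def]) (simp only: S_def)
  qed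
qed


section \<open>Complete exceptional sequences and their forests\<close>

lemma interval_module_pair_exceptional:
  assumes "interval_module n V a b" "interval_module n W c d"
  shows "hom_vanishes n V W \<and> ext1_vanishes n V W \<longleftrightarrow> compat c d a b"
proof -
  interpret interval_module_pair n V W a b c d using assms by unfold_locales
  show ?thesis using hom_vanishes_iff ext1_vanishes_iff by (simp add: compat_def)
qed

lemma rigid_interval_module:
  assumes "interval_module n V a b" shows "rigid n V"
proof -
  interpret interval_module_pair n V V a b a b using assms by unfold_locales
  show ?thesis using ext1_vanishes_iff by (simp add: rigid_def)
qed

lemma complete_exceptional_intervals:
  assumes "complete_exceptional n E"
  obtains l r where "\<And>k. k \<in> {1..n} \<Longrightarrow> interval_module n (E k) (l k) (r k)"
    and "interval_seq {1..n} n l r"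
proof -
  have "\<exists>a b. interval_module n (E k) a b" if "k \<in> {1..n}" for k
  proof -
    have "indecomposable n (E k)" using assms that unfolding complete_exceptional_def by simp
    then obtain a b where "interval_module n (E k) a b" by (rule interval_module_if_indecomposable)
    then show ?thesis by blast
  qed
  then obtain l r where lr: "\<And>k. k \<in> {1..n} \<Longrightarrow> interval_module n (E k) (l k) (r k)"
    by metis
  have "interval_seq {1..n} n l r"
  proof
    show "1 \<le> l k \<and> l k \<le> r k \<and> r k \<le> n" if "k \<in> {1..n}" for k
      using interval_moduleD(2-4)[OF lr[OF that]] by simp
    show "compat (l i) (r i) (l j) (r j)" if "i \<in> {1..n}" "j \<in> {1..n}" "i < j" for i j
    proof -
      have "hom_vanishes n (E j) (E i) \<and> ext1_vanishes n (E j) (E i)"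
        using assms that unfolding complete_exceptional_def by simp
      then show ?thesis
        unfolding interval_module_pair_exceptional[OF lr[OF that(2)] lr[OF that(1)]] .
    qed
  qed simp
  with lr show ?thesis by (rule that)
qed

lemma complete_exceptional_if_intervals:
  assumes lr: "\<And>k. k \<in> {1..n} \<Longrightarrow> interval_module n (E k) (l k) (r k)"
    and seq: "interval_seq {1..n} n l r"
  shows "complete_exceptional n E"
  unfolding complete_exceptional_def
proof (intro conjI ballI impI)
  fix i assume i: "i \<in> {1..n}"
  show "indecomposable n (E i)" "rigid n (E i)"
    using indecomposable_interval_module[OF lr[OF i]] rigid_interval_module[OF lr[OF i]] by auto
next
  fix i j assume ij: "i \<in> {1..n}" "j \<in> {1..n}" "i < j"
  have "compat (l i) (r i) (l j) (r j)" using interval_seq.comp[OF seq ij] .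
  then show "hom_vanishes n (E j) (E i)" "ext1_vanishes n (E j) (E i)"
    using interval_module_pair_exceptional[OF lr[OF ij(2)] lr[OF ij(1)]] by auto
qed

lemma interval_module_unique:
  assumes "interval_module n V a b" "interval_module n V c d"
  shows "a = c \<and> b = d"
  using supp_interval_module[OF assms(1)] supp_interval_module[OF assms(2)]
    interval_moduleD(3)[OF assms(1)] interval_moduleD(3)[OF assms(2)]
  by (simp add: Icc_eq_Icc)

text \<open>\<open>forest_of\<close> compares labels and non-strict inclusions, \<open>tree\<close>
  strict inclusions; they agree because distinct positions carry distinct intervals.\<close>

lemma forest_of_intervals:
  assumes lr: "\<And>k. k \<in> {1..n} \<Longrightarrow> interval_module n (E k) (l k) (r k)"
    and seq: "interval_seq {1..n} n l r"
  shows "forest_of n E = tree {1..n} (ivals l r)"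
proof -
  interpret interval_seq "{1..n}" n l r by fact
  have supp: "supp n (E k) = ivals l r k" if "k \<in> {1..n}" for k
    using supp_interval_module[OF lr[OF that]] by (simp add: ivals_def)
  have inj: "S i = S j \<longleftrightarrow> i = j" if "i \<in> {1..n}" "j \<in> {1..n}" for i j
    by (rule iffI[OF laminar_on_eqD[OF laminar_on that]]) simp_all
  have psub: "S i \<subset> S j \<longleftrightarrow> i \<noteq> j \<and> S i \<subseteq> S j" if "i \<in> {1..n}" "j \<in> {1..n}" for i j
    unfolding psubset_eq inj[OF that] by (rule conj_commute)
  have "(i, j) \<in> forest_of n E \<longleftrightarrow> (i, j) \<in> tree {1..n} S" for i j
  proof (cases "i \<in> {1..n} \<and> j \<in> {1..n}")
    case True
    then have ij: "i \<in> {1..n}" "j \<in> {1..n}" by auto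
    have eqk: "k \<in> {1..n} - {i, j} \<and> supp n (E i) \<subseteq> supp n (E k) \<and> supp n (E k) \<subseteq> supp n (E j) \<longleftrightarrow>
      k \<in> {1..n} \<and> S i \<subset> S k \<and> S k \<subset> S j" for k
    proof (cases "k \<in> {1..n}")
      case True
      then show ?thesis
        unfolding psub[OF ij(1) True] psub[OF True ij(2)] supp[OF True] supp[OF ij(1)] supp[OF ij(2)]
        by blast
    next
      case False
      then show ?thesis by blast
    qed
    have between: "(\<exists>k\<in>{1..n} - {i, j}. supp n (E i) \<subseteq> supp n (E k) \<and> supp n (E k) \<subseteq> supp n (E j)) \<longleftrightarrow>
      (\<exists>k\<in>{1..n}. S i \<subset> S k \<and> S k \<subset> S j)"
      unfolding Bex_def by (rule ex_cong1[OF eqk])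
    have "(i, j) \<in> forest_of n E \<longleftrightarrow> i \<noteq> j \<and> supp n (E i) \<subseteq> supp n (E j) \<and>
        \<not> (\<exists>k\<in>{1..n} - {i, j}. supp n (E i) \<subseteq> supp n (E k) \<and> supp n (E k) \<subseteq> supp n (E j))"
      unfolding forest_of_def using ij by blast
    also have "\<dots> \<longleftrightarrow> S i \<subset> S j \<and> \<not> (\<exists>k\<in>{1..n}. S i \<subset> S k \<and> S k \<subset> S j)"
      unfolding between unfolding supp[OF ij(1)] supp[OF ij(2)] psub[OF ij]
      by (rule conj_assoc[symmetric])
    also have "\<dots> \<longleftrightarrow> (i, j) \<in> tree {1..n} S" using ij by (simp add: tree_def)
    finally show ?thesis .
  next
    case False
    then have "(i, j) \<notin> forest_of n E" "(i, j) \<notin> tree {1..n} S"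
      by (auto simp: forest_of_def tree_def)
    then show ?thesis by simp
  qed
  then show ?thesis by (intro equalityI subrelI) blast+
qed

lemma rooted_labeled_forest_tree:
  assumes "laminar_on {1..n} S"
  shows "rooted_labeled_forest n (tree {1..n} S)"
  unfolding rooted_labeled_forest_def
proof (intro conjI)
  show "tree {1..n} S \<subseteq> {1..n} \<times> {1..n}" by (auto simp: tree_def)
  show "single_valued (tree {1..n} S)" by (rule single_valued_tree[OF assms])
  have "S u \<subset> S v" if "(u, v) \<in> (tree {1..n} S)\<^sup>+" for u v
    using that
  proof (induction rule: trancl_induct)
    case (base v)
    then show ?case by (rule treeD(3))
  next
    case (step v w)
    show ?case by (rule psubset_trans[OF step.IH treeD(3)[OF step.hyps(2)]])
  qed
  then show "acyclic (tree {1..n} S)" unfolding acyclic_def by blast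
qed

text \<open>No other interval reaches \<open>n + 1\<close>, so node 0 is strictly above all others.
  It never lies between two of them, and it is the parent of exactly those nodes that have no parent
  in the forest.\<close>

lemma forest_plus_tree:
  assumes seq: "interval_seq {1..n} n l r"
  shows "forest_plus n (tree {1..n} (ivals l r)) =
    tree {0..n} (ivals (l(0 := 1)) (r(0 := Suc n)))" (is "?A = tree _ ?S")
proof -
  interpret interval_seq "{1..n}" n l r by fact
  interpret C: complete_interval_seq "{0..n}" "Suc n" "l(0 := 1)" "r(0 := Suc n)"
    by (rule interval_seq_extend[OF seq])
  have S: "?S k = S k" if "k \<in> {1..n}" for k using that by (auto simp: ivals_def)
  have S0: "S k \<subset> ?S 0" if "k \<in> {1..n}" for k
    using bounds[OF that] by (auto simp: ivals_def atLeastatMost_psubset_iff)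
  have K: "{0..n} = insert 0 {1..n}" by auto
  have T: "(u, v) \<in> tree {0..n} ?S \<longleftrightarrow> (u, v) \<in> tree {1..n} S" if "v \<noteq> 0" for u v
  proof (cases "v \<in> {1..n}")
    case True
    have no0: "\<not> ?S 0 \<subset> S w" if "w \<in> {1..n}" for w using S0[OF that] by blast
    show ?thesis
    proof (cases "u \<in> {1..n}")
      case u: True
      then show ?thesis unfolding tree_def K using True S no0[OF True] by simp
    next
      case False
      then show ?thesis unfolding tree_def K using True S no0[OF True] by auto
    qed
  next
    case False
    then show ?thesis using that by (auto simp: tree_def)
  qed
  have T0: "(u, 0) \<in> tree {0..n} ?S \<longleftrightarrow> u \<in> {1..n} \<and> (\<nexists>w. (u, w) \<in> tree {1..n} S)" for u
  proof (cases "u \<in> {1..n}")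
    case True
    have "(u, 0) \<in> tree {0..n} ?S \<longleftrightarrow> \<not> (\<exists>w\<in>{1..n}. S u \<subset> S w)"
    proof -
      have "(u, 0) \<in> tree {0..n} ?S \<longleftrightarrow> ?S u \<subset> ?S 0 \<and> \<not> (\<exists>w\<in>{0..n}. ?S u \<subset> ?S w \<and> ?S w \<subset> ?S 0)"
        using True by (simp add: tree_def)
      also have "\<dots> \<longleftrightarrow> \<not> (\<exists>w\<in>{1..n}. S u \<subset> S w)"
        unfolding K using S[OF True] S S0 S0[OF True] by simp
      finally show ?thesis .
    qed
    also have "(\<exists>w\<in>{1..n}. S u \<subset> S w) \<longleftrightarrow> (\<exists>w. (u, w) \<in> tree {1..n} S)"
    proof
      assume "\<exists>w\<in>{1..n}. S u \<subset> S w"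
      then obtain w where "w \<in> {1..n}" "S u \<subset> S w" by blast
      then obtain k where "(u, k) \<in> tree {1..n} S"
        by (rule tree_parent_exists[OF laminar_on True])
      then show "\<exists>w. (u, w) \<in> tree {1..n} S" by blast
    next
      assume "\<exists>w. (u, w) \<in> tree {1..n} S"
      then obtain w where w: "(u, w) \<in> tree {1..n} S" by blast
      show "\<exists>w\<in>{1..n}. S u \<subset> S w" by (rule bexI[of _ w]) (rule treeD(3)[OF w], rule treeD(2)[OF w])
    qed
    finally show ?thesis using True by blast
  next
    case False
    then show ?thesis unfolding tree_def K by auto
  qed
  have "(u, v) \<in> ?A \<longleftrightarrow> (u, v) \<in> tree {0..n} ?S" for u v
  proof (cases "v = 0")
    case True
    then show ?thesis using T0[of u] unfolding forest_plus_def by (auto simp: tree_def)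
  next
    case False
    then show ?thesis using T[of v u] unfolding forest_plus_def by blast
  qed
  then show ?thesis by (intro equalityI subrelI) blast+
qed

theorem theorem2p1:
  fixes E :: "nat \<Rightarrow> 'k::field qrep"
    and F :: "(nat \<times> nat) set"
    and n i :: nat
  assumes "complete_exceptional n E"
    and "F = forest_of n E"
    and "1 \<le> i" and "i < n"
  shows "rooted_labeled_forest n F \<and>
         complete_exceptional n (sigma_seq n i E) \<and>
         forest_of n (sigma_seq n i E) = sigma_forest n i F"
proof -
  obtain l r where lr: "\<And>k. k \<in> {1..n} \<Longrightarrow> interval_module n (E k) (l k) (r k)"
    and seq: "interval_seq {1..n} n l r"
    using complete_exceptional_intervals[OF assms(1)] by blast
  have F: "F = tree {1..n} (ivals l r)"
    using forest_of_intervals[OF lr seq] assms(2) by simp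
  obtain a b where
    seq': "interval_seq {1..n} n (l(i := a, Suc i := l i)) (r(i := b, Suc i := r i))"
    and sig: "sigma_tree i (tree {0..n} (ivals (l(0 := 1)) (r(0 := Suc n)))) =
      tree {0..n} (ivals (l(i := a, Suc i := l i, 0 := 1)) (r(i := b, Suc i := r i, 0 := Suc n)))"
    using mutate_interval_seq[OF seq assms(3,4)] by blast
  let ?l = "l(i := a, Suc i := l i)" and ?r = "r(i := b, Suc i := r i)"
  have iK: "i \<in> {1..n}" "Suc i \<in> {1..n}" using assms(3,4) by auto
  let ?P = "\<lambda>X. complete_exceptional n (E(i := X, i + 1 := E i))"
  have "1 \<le> a" "a \<le> b" "b \<le> n" using interval_seq.bounds[OF seq' iK(1)] by auto
  \<comment> \<open>The witness that the predicate under \<open>SOME\<close> is satisfiable; the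
    module actually chosen may be a different one.\<close>
  then obtain X0 :: "'k qrep" where X0: "interval_module n X0 a b"
    using interval_module_exists by blast
  have "?P X0"
  proof (rule complete_exceptional_if_intervals[OF _ seq'])
    fix k assume "k \<in> {1..n}"
    then show "interval_module n ((E(i := X0, i + 1 := E i)) k) (?l k) (?r k)"
      using lr X0 iK by simp
  qed
  then have ce: "?P (SOME X. ?P X)" by (rule someI)
  define E' where "E' = sigma_seq n i E"
  define X where "X = (SOME X. ?P X)"
  have E': "E' = E(i := X, i + 1 := E i)" by (simp add: E'_def sigma_seq_def X_def)
  have ce': "complete_exceptional n E'" using ce by (simp add: E' X_def)
  obtain l' r' where lr': "\<And>k. k \<in> {1..n} \<Longrightarrow> interval_module n (E' k) (l' k) (r' k)"
    and seq'': "interval_seq {1..n} n l' r'"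
    using complete_exceptional_intervals[OF ce'] by blast
  have same: "l' k = ?l k \<and> r' k = ?r k" if "k \<in> {1..n}" "k \<noteq> i" for k
    using interval_module_unique[OF lr'[OF that(1)], of "?l k" "?r k"] lr[OF that(1)] lr[OF iK(1)] that
    by (cases "k = Suc i") (simp_all add: E')
  \<comment> \<open>The intervals of the chosen sequence, rewritten to differ from the constructed
    ones at position \<open>i\<close> only, as \<open>interval_seq_unique\<close> requires.\<close>
  have old: "interval_seq {1..n} n (?l(i := l' i)) (?r(i := r' i))"
  proof
    have eq: "(?l(i := l' i)) k = l' k" "(?r(i := r' i)) k = r' k" if "k \<in> {1..n}" for k
      using same[OF that] by auto
    show "1 \<le> (?l(i := l' i)) k \<and> (?l(i := l' i)) k \<le> (?r(i := r' i)) k \<and> (?r(i := r' i)) k \<le> n"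
      if "k \<in> {1..n}" for k
      using interval_seq.bounds[OF seq'' that] unfolding eq[OF that] .
    show "compat ((?l(i := l' i)) u) ((?r(i := r' i)) u) ((?l(i := l' i)) v) ((?r(i := r' i)) v)"
      if "u \<in> {1..n}" "v \<in> {1..n}" "u < v" for u v
      using interval_seq.comp[OF seq'' that] unfolding eq[OF that(1)] eq[OF that(2)] .
  qed simp
  have new: "interval_seq {1..n} n (?l(i := a)) (?r(i := b))"
    using seq' by (simp add: fun_upd_twist)
  have "l' i = a \<and> r' i = b" by (rule interval_seq_unique[OF old new iK(1)])
  then have "l' k = ?l k \<and> r' k = ?r k" if "k \<in> {1..n}" for k
    using same[OF that] by (cases "k = i") auto
  then have "interval_module n (E' k) (?l k) (?r k)" if "k \<in> {1..n}" for k
    using lr'[OF that] that by simp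
  then have F': "forest_of n E' = tree {1..n} (ivals ?l ?r)"
    by (rule forest_of_intervals[OF _ seq'])
  have "sigma_forest n i F = {(u, v) \<in> forest_plus n (forest_of n E'). v \<noteq> 0}"
    unfolding sigma_forest_def F F' forest_plus_tree[OF seq] forest_plus_tree[OF seq'] sig by (rule refl)
  \<comment> \<open>Dropping the edges into the master root undoes
    \<open>forest_plus\<close>.\<close>
  also have "\<dots> = forest_of n E'" unfolding forest_plus_def F' by (auto simp: tree_def)
  finally have "forest_of n E' = sigma_forest n i F" by (rule sym)
  moreover have "rooted_labeled_forest n F"
    unfolding F by (rule rooted_labeled_forest_tree[OF interval_seq.laminar_on[OF seq]])
  ultimately show ?thesis using ce' unfolding E'_def by simp
qed

end
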